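(* Let $A$ be a noetherian ring containing $\mathbb{Q}$. Let $\mathfrak{a}$ be an ideal of $A$ such that $A/\mathfrak{a}$ has finite integral degree $\mathrm{d}_{A/\mathfrak{a}}(\overline{A/\mathfrak{a}})=d$. Let $I$ be an ideal of $A$ such that the ideal $I(A/\mathfrak{a})$ of $A/\mathfrak{a}$ has an $A/\mathfrak{a}$-regular principal reduction. Then, for every integer $n\ge d$, $$I^{n}\cap\mathfrak{a}=I^{n-d}(I^{d}\cap\mathfrak{a}).$$
   Context: All rings are commutative with identity. For an ideal $I$ of a ring $R$, an ideal $J\subseteq I$ is a reduction of $I$ if $I^{n+1}=JI^{n}$ for some integer $n\ge 0$; it is a principal reduction if moreover $J$ is a principal ideal. An ideal of $R$ is $R$-regular if it is not contained in the set of zero divisors of $R$, i.e. it contains a non zero divisor of $R$. Integral degree: if $R\subseteq B$ is a ring extension and $b\in B$ is integral over $R$, then $\mathrm{id}_R(b)$ is the least $n\ge1$ such that $b$ satisfies a monic polynomial equation of degree $n$ with coefficients in $R$. If $R\subseteq B$ is an integral extension, $\mathrm{d}_R(B)=\sup\{\mathrm{id}_R(b)\mid b\in B\}$. $\overline{R}$ denotes the integral closure of $R$ in its total quotient ring, and $\mathrm{d}_R(\overline{R})$ is called the integral degree of $R$. *)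

theory Defs
  imports "HOL-Algebra.Algebra" "HOL-Library.Extended_Nat"
begin

section \<open>Ideals: powers, extensions, reductions\<close>

text \<open>Powers are taken in the commutative monoid of ideals, so the zeroth power is the whole ring.\<close>

definition ideal_pow :: "('a, 'b) ring_scheme \<Rightarrow> 'a set \<Rightarrow> nat \<Rightarrow> 'a set"
  where "ideal_pow R I n = I [^]\<^bsub>ideals_set R\<^esub> n"

definition ideal_ext :: "('a, 'b) ring_scheme \<Rightarrow> 'a set \<Rightarrow> 'a set \<Rightarrow> 'a set set"
  where "ideal_ext R J I = Idl\<^bsub>R Quot J\<^esub> ((\<lambda>x. J +>\<^bsub>R\<^esub> x) ` I)"

definition is_reduction :: "('a, 'b) ring_scheme \<Rightarrow> 'a set \<Rightarrow> 'a set \<Rightarrow> bool"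
  where "is_reduction R J I \<longleftrightarrow> ideal J R \<and> J \<subseteq> I \<and>
    (\<exists>n. ideal_pow R I (n + 1) = ideal_prod R J (ideal_pow R I n))"

definition is_principal_reduction :: "('a, 'b) ring_scheme \<Rightarrow> 'a set \<Rightarrow> 'a set \<Rightarrow> bool"
  where "is_principal_reduction R J I \<longleftrightarrow> is_reduction R J I \<and> principalideal J R"

definition non_zero_divisors :: "('a, 'b) ring_scheme \<Rightarrow> 'a set"
  where "non_zero_divisors R =
    {s \<in> carrier R. \<forall>x \<in> carrier R. s \<otimes>\<^bsub>R\<^esub> x = \<zero>\<^bsub>R\<^esub> \<longrightarrow> x = \<zero>\<^bsub>R\<^esub>}"

definition is_regular_ideal :: "('a, 'b) ring_scheme \<Rightarrow> 'a set \<Rightarrow> bool"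
  where "is_regular_ideal R J \<longleftrightarrow> ideal J R \<and> J \<inter> non_zero_divisors R \<noteq> {}"


section \<open>The total quotient ring\<close>

definition frac_rel :: "('a, 'b) ring_scheme \<Rightarrow> (('a \<times> 'a) \<times> ('a \<times> 'a)) set"
  where "frac_rel R = {((a, s), (b, t)).
    a \<in> carrier R \<and> s \<in> non_zero_divisors R \<and> b \<in> carrier R \<and> t \<in> non_zero_divisors R \<and>
    a \<otimes>\<^bsub>R\<^esub> t = b \<otimes>\<^bsub>R\<^esub> s}"

definition fraction :: "('a, 'b) ring_scheme \<Rightarrow> 'a \<Rightarrow> 'a \<Rightarrow> ('a \<times> 'a) set"
  where "fraction R a s = frac_rel R `` {(a, s)}"

text \<open>The operations are unions over all representatives; these collapse to the expected
  single class by \<open>tq_mult\<close> and \<open>tq_add\<close> below.\<close>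

definition total_quotient_ring :: "('a, 'b) ring_scheme \<Rightarrow> ('a \<times> 'a) set ring"
  where "total_quotient_ring R =
    \<lparr> carrier = (carrier R \<times> non_zero_divisors R) // frac_rel R,
      monoid.mult = (\<lambda>p q. \<Union>(a, s) \<in> p. \<Union>(b, t) \<in> q. fraction R (a \<otimes>\<^bsub>R\<^esub> b) (s \<otimes>\<^bsub>R\<^esub> t)),
      one = fraction R \<one>\<^bsub>R\<^esub> \<one>\<^bsub>R\<^esub>,
      ring.zero = fraction R \<zero>\<^bsub>R\<^esub> \<one>\<^bsub>R\<^esub>,
      add = (\<lambda>p q. \<Union>(a, s) \<in> p. \<Union>(b, t) \<in> q.
        fraction R ((a \<otimes>\<^bsub>R\<^esub> t) \<oplus>\<^bsub>R\<^esub> (b \<otimes>\<^bsub>R\<^esub> s)) (s \<otimes>\<^bsub>R\<^esub> t)) \<rparr>"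

definition tq_embed :: "('a, 'b) ring_scheme \<Rightarrow> 'a \<Rightarrow> ('a \<times> 'a) set"
  where "tq_embed R r = fraction R r \<one>\<^bsub>R\<^esub>"

lemma (in cring) nzd_closed: "s \<in> non_zero_divisors R \<Longrightarrow> s \<in> carrier R"
  by (simp add: non_zero_divisors_def)

lemma (in cring) nzd_one: "\<one> \<in> non_zero_divisors R"
  by (simp add: non_zero_divisors_def)

lemma (in cring) nzd_mult:
  assumes "s \<in> non_zero_divisors R" "t \<in> non_zero_divisors R"
  shows "s \<otimes> t \<in> non_zero_divisors R"
proof -
  have c: "s \<in> carrier R" "t \<in> carrier R" using assms by (auto intro: nzd_closed)
  have "x = \<zero>" if x: "x \<in> carrier R" and z: "s \<otimes> t \<otimes> x = \<zero>" for x
  proof -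
    have "s \<otimes> (t \<otimes> x) = \<zero>" using z m_assoc[OF c x] by simp
    then have "t \<otimes> x = \<zero>" using assms(1) c x by (simp add: non_zero_divisors_def)
    then show ?thesis using assms(2) x by (simp add: non_zero_divisors_def)
  qed
  then show ?thesis using c by (simp add: non_zero_divisors_def)
qed

lemma (in cring) nzd_cancel:
  assumes s: "s \<in> non_zero_divisors R" and x: "x \<in> carrier R" and y: "y \<in> carrier R"
    and eq: "s \<otimes> x = s \<otimes> y"
  shows "x = y"
proof -
  have sc: "s \<in> carrier R" using s by (rule nzd_closed)
  have "s \<otimes> (x \<ominus> y) = s \<otimes> x \<ominus> s \<otimes> y"
    using sc x y by algebra
  also have "\<dots> = \<zero>" using sc x y eq by (simp add: r_right_minus_eq)
  finally have "x \<ominus> y = \<zero>" using s x y by (simp add: non_zero_divisors_def)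
  then show ?thesis using x y r_right_minus_eq by blast
qed

lemma (in cring) frac_rel_equiv:
  "equiv (carrier R \<times> non_zero_divisors R) (frac_rel R)"
proof (rule equivI)
  show "frac_rel R \<subseteq> (carrier R \<times> non_zero_divisors R) \<times> (carrier R \<times> non_zero_divisors R)"
    by (auto simp: frac_rel_def)
  show "refl_on (carrier R \<times> non_zero_divisors R) (frac_rel R)"
    by (auto simp: refl_on_def frac_rel_def)
  show "sym (frac_rel R)"
    by (auto simp: sym_def frac_rel_def)
  show "trans (frac_rel R)"
  proof (rule transI, clarify)
    fix a s b t c u
    assume 1: "((a, s), (b, t)) \<in> frac_rel R" and 2: "((b, t), (c, u)) \<in> frac_rel R"
    have c: "a \<in> carrier R" "b \<in> carrier R" "c \<in> carrier R" "s \<in> carrier R" "t \<in> carrier R" "u \<in> carrier R"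
      and n: "s \<in> non_zero_divisors R" "t \<in> non_zero_divisors R" "u \<in> non_zero_divisors R"
      and e1: "a \<otimes> t = b \<otimes> s" and e2: "b \<otimes> u = c \<otimes> t"
      using 1 2 by (auto simp: frac_rel_def nzd_closed)
    have "t \<otimes> (a \<otimes> u) = (a \<otimes> t) \<otimes> u" using c by algebra
    also have "\<dots> = (b \<otimes> u) \<otimes> s" unfolding e1 using c by algebra
    also have "\<dots> = t \<otimes> (c \<otimes> s)" unfolding e2 using c by algebra
    finally have "a \<otimes> u = c \<otimes> s"
      using nzd_cancel[OF n(2)] c by simp
    then show "((a, s), (c, u)) \<in> frac_rel R" using c n by (auto simp: frac_rel_def)
  qed
qed

lemma (in cring) fraction_eq_iff:
  assumes "a \<in> carrier R" "s \<in> non_zero_divisors R" "b \<in> carrier R" "t \<in> non_zero_divisors R"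
  shows "fraction R a s = fraction R b t \<longleftrightarrow> a \<otimes> t = b \<otimes> s"
proof -
  have "fraction R a s = fraction R b t \<longleftrightarrow> ((a, s), (b, t)) \<in> frac_rel R"
    unfolding fraction_def using assms by (intro eq_equiv_class_iff[OF frac_rel_equiv]) auto
  then show ?thesis using assms by (simp add: frac_rel_def)
qed

lemma (in cring) fraction_closed:
  assumes "a \<in> carrier R" "s \<in> non_zero_divisors R"
  shows "fraction R a s \<in> carrier (total_quotient_ring R)"
  using assms by (auto simp: total_quotient_ring_def fraction_def intro: quotientI)

lemma (in cring) tq_cases:
  assumes "p \<in> carrier (total_quotient_ring R)"
  obtains a s where "a \<in> carrier R" "s \<in> non_zero_divisors R" "p = fraction R a s"
  using assms by (auto simp: total_quotient_ring_def fraction_def elim!: quotientE)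

lemma UN_pair_const:
  assumes "\<And>a s b t. (a, s) \<in> p \<Longrightarrow> (b, t) \<in> q \<Longrightarrow> f a s b t = C"
    and "(a0, s0) \<in> p" "(b0, t0) \<in> q"
  shows "(\<Union>(a, s) \<in> p. \<Union>(b, t) \<in> q. f a s b t) = C"
  using assms by fast

lemma (in cring) tq_mult:
  assumes "a \<in> carrier R" "s \<in> non_zero_divisors R" "b \<in> carrier R" "t \<in> non_zero_divisors R"
  shows "fraction R a s \<otimes>\<^bsub>total_quotient_ring R\<^esub> fraction R b t = fraction R (a \<otimes> b) (s \<otimes> t)"
proof -
  have "fraction R (a' \<otimes> b') (s' \<otimes> t') = fraction R (a \<otimes> b) (s \<otimes> t)"
    if "(a', s') \<in> fraction R a s" "(b', t') \<in> fraction R b t" for a' s' b' t'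
  proof -
    have c: "a \<in> carrier R" "s \<in> carrier R" "b \<in> carrier R" "t \<in> carrier R"
      "a' \<in> carrier R" "s' \<in> carrier R" "b' \<in> carrier R" "t' \<in> carrier R"
      and n: "s' \<in> non_zero_divisors R" "t' \<in> non_zero_divisors R"
      and e: "a \<otimes> s' = a' \<otimes> s" "b \<otimes> t' = b' \<otimes> t"
      using that assms by (auto simp: fraction_def frac_rel_def nzd_closed)
    have "(a' \<otimes> b') \<otimes> (s \<otimes> t) = (a' \<otimes> s) \<otimes> (b' \<otimes> t)" using c by algebra
    also have "\<dots> = (a \<otimes> b) \<otimes> (s' \<otimes> t')" unfolding e[symmetric] using c by algebra
    finally show ?thesis using c n assms by (simp add: fraction_eq_iff nzd_mult)
  qed
  moreover have "(a, s) \<in> fraction R a s" "(b, t) \<in> fraction R b t"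
    using assms by (auto simp: fraction_def frac_rel_def)
  ultimately show ?thesis
    unfolding total_quotient_ring_def monoid.simps
    by (rule UN_pair_const)
qed

lemma (in cring) tq_add:
  assumes "a \<in> carrier R" "s \<in> non_zero_divisors R" "b \<in> carrier R" "t \<in> non_zero_divisors R"
  shows "fraction R a s \<oplus>\<^bsub>total_quotient_ring R\<^esub> fraction R b t =
    fraction R (a \<otimes> t \<oplus> b \<otimes> s) (s \<otimes> t)"
proof -
  have "fraction R (a' \<otimes> t' \<oplus> b' \<otimes> s') (s' \<otimes> t') = fraction R (a \<otimes> t \<oplus> b \<otimes> s) (s \<otimes> t)"
    if "(a', s') \<in> fraction R a s" "(b', t') \<in> fraction R b t" for a' s' b' t'
  proof -
    have c: "a \<in> carrier R" "s \<in> carrier R" "b \<in> carrier R" "t \<in> carrier R"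
      "a' \<in> carrier R" "s' \<in> carrier R" "b' \<in> carrier R" "t' \<in> carrier R"
      and n: "s' \<in> non_zero_divisors R" "t' \<in> non_zero_divisors R"
      and e: "a \<otimes> s' = a' \<otimes> s" "b \<otimes> t' = b' \<otimes> t"
      using that assms by (auto simp: fraction_def frac_rel_def nzd_closed)
    have "(a' \<otimes> t' \<oplus> b' \<otimes> s') \<otimes> (s \<otimes> t) = (a' \<otimes> s) \<otimes> (t \<otimes> t') \<oplus> (b' \<otimes> t) \<otimes> (s \<otimes> s')"
      using c by algebra
    also have "\<dots> = (a \<otimes> t \<oplus> b \<otimes> s) \<otimes> (s' \<otimes> t')" unfolding e[symmetric] using c by algebra
    finally show ?thesis using c n assms by (simp add: fraction_eq_iff nzd_mult)
  qed
  moreover have "(a, s) \<in> fraction R a s" "(b, t) \<in> fraction R b t"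
    using assms by (auto simp: fraction_def frac_rel_def)
  ultimately show ?thesis
    unfolding total_quotient_ring_def ring.simps
    by (rule UN_pair_const)
qed

lemma (in cring) tq_one: "\<one>\<^bsub>total_quotient_ring R\<^esub> = fraction R \<one> \<one>"
  by (simp add: total_quotient_ring_def)

lemma (in cring) tq_zero: "\<zero>\<^bsub>total_quotient_ring R\<^esub> = fraction R \<zero> \<one>"
  by (simp add: total_quotient_ring_def)

lemma (in cring) tq_is_cring: "cring (total_quotient_ring R)"
proof -
  let ?Q = "total_quotient_ring R"
  note n = nzd_mult nzd_one nzd_closed
  note S = tq_mult tq_add tq_one tq_zero fraction_closed n
  show ?thesis
  proof (rule cringI)
    show "abelian_group ?Q"
    proof (rule abelian_groupI)
      fix p q assume "p \<in> carrier ?Q" "q \<in> carrier ?Q"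
      then show "p \<oplus>\<^bsub>?Q\<^esub> q \<in> carrier ?Q" by (elim tq_cases) (simp add: S)
    next
      show "\<zero>\<^bsub>?Q\<^esub> \<in> carrier ?Q" by (simp add: S)
    next
      fix p q r assume "p \<in> carrier ?Q" "q \<in> carrier ?Q" "r \<in> carrier ?Q"
      then obtain a s b t c u where h: "a \<in> carrier R" "s \<in> non_zero_divisors R" "p = fraction R a s"
        "b \<in> carrier R" "t \<in> non_zero_divisors R" "q = fraction R b t"
        "c \<in> carrier R" "u \<in> non_zero_divisors R" "r = fraction R c u"
        by (meson tq_cases)
      have c: "s \<in> carrier R" "t \<in> carrier R" "u \<in> carrier R" using h by (simp_all add: n)
      have "(a \<otimes> t \<oplus> b \<otimes> s) \<otimes> u \<oplus> c \<otimes> (s \<otimes> t) = a \<otimes> (t \<otimes> u) \<oplus> (b \<otimes> u \<oplus> c \<otimes> t) \<otimes> s"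
        "s \<otimes> t \<otimes> u = s \<otimes> (t \<otimes> u)"
        using h(1,4,7) c by algebra+
      then show "p \<oplus>\<^bsub>?Q\<^esub> q \<oplus>\<^bsub>?Q\<^esub> r = p \<oplus>\<^bsub>?Q\<^esub> (q \<oplus>\<^bsub>?Q\<^esub> r)"
        using h c by (simp only: tq_add nzd_mult m_closed a_closed)
    next
      fix p q assume "p \<in> carrier ?Q" "q \<in> carrier ?Q"
      then obtain a s b t where h: "a \<in> carrier R" "s \<in> non_zero_divisors R" "p = fraction R a s"
        "b \<in> carrier R" "t \<in> non_zero_divisors R" "q = fraction R b t"
        by (meson tq_cases)
      have c: "s \<in> carrier R" "t \<in> carrier R" using h by (simp_all add: n)
      have "a \<otimes> t \<oplus> b \<otimes> s = b \<otimes> s \<oplus> a \<otimes> t" "s \<otimes> t = t \<otimes> s"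
        using h(1,4) c by algebra+
      then show "p \<oplus>\<^bsub>?Q\<^esub> q = q \<oplus>\<^bsub>?Q\<^esub> p"
        unfolding h(3,6) tq_add[OF h(1,2,4,5)] tq_add[OF h(4,5,1,2)] by argo
    next
      fix p assume "p \<in> carrier ?Q"
      then show "\<zero>\<^bsub>?Q\<^esub> \<oplus>\<^bsub>?Q\<^esub> p = p" by (elim tq_cases) (simp add: S)
    next
      fix p assume "p \<in> carrier ?Q"
      then obtain a s where h: "a \<in> carrier R" "s \<in> non_zero_divisors R" "p = fraction R a s"
        by (rule tq_cases)
      have c: "s \<in> carrier R" using h by (simp add: n)
      have "(\<ominus> a \<otimes> s \<oplus> a \<otimes> s) \<otimes> \<one> = \<zero> \<otimes> (s \<otimes> s)" using h(1) c by algebra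
      then have "fraction R (\<ominus> a) s \<oplus>\<^bsub>?Q\<^esub> p = \<zero>\<^bsub>?Q\<^esub>"
        unfolding h(3) tq_add[OF a_inv_closed[OF h(1)] h(2) h(1,2)] tq_zero
        using h c by (subst fraction_eq_iff) (simp_all add: n)
      moreover have "fraction R (\<ominus> a) s \<in> carrier ?Q" using h by (simp add: S)
      ultimately show "\<exists>q\<in>carrier ?Q. q \<oplus>\<^bsub>?Q\<^esub> p = \<zero>\<^bsub>?Q\<^esub>" by blast
    qed
    show "comm_monoid ?Q"
    proof (rule comm_monoidI)
      fix p q assume "p \<in> carrier ?Q" "q \<in> carrier ?Q"
      then show "p \<otimes>\<^bsub>?Q\<^esub> q \<in> carrier ?Q" by (elim tq_cases) (simp add: S)
    next
      show "\<one>\<^bsub>?Q\<^esub> \<in> carrier ?Q" by (simp add: S)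
    next
      fix p q r assume "p \<in> carrier ?Q" "q \<in> carrier ?Q" "r \<in> carrier ?Q"
      then show "p \<otimes>\<^bsub>?Q\<^esub> q \<otimes>\<^bsub>?Q\<^esub> r = p \<otimes>\<^bsub>?Q\<^esub> (q \<otimes>\<^bsub>?Q\<^esub> r)"
        by (elim tq_cases) (simp add: S m_assoc)
    next
      fix p assume "p \<in> carrier ?Q"
      then show "\<one>\<^bsub>?Q\<^esub> \<otimes>\<^bsub>?Q\<^esub> p = p" by (elim tq_cases) (simp add: S)
    next
      fix p q assume "p \<in> carrier ?Q" "q \<in> carrier ?Q"
      then show "p \<otimes>\<^bsub>?Q\<^esub> q = q \<otimes>\<^bsub>?Q\<^esub> p" by (elim tq_cases) (simp add: S m_comm)
    qed
    fix p q r assume "p \<in> carrier ?Q" "q \<in> carrier ?Q" "r \<in> carrier ?Q"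
    then obtain a s b t c u where h: "a \<in> carrier R" "s \<in> non_zero_divisors R" "p = fraction R a s"
      "b \<in> carrier R" "t \<in> non_zero_divisors R" "q = fraction R b t"
      "c \<in> carrier R" "u \<in> non_zero_divisors R" "r = fraction R c u"
      by (meson tq_cases)
    have c: "s \<in> carrier R" "t \<in> carrier R" "u \<in> carrier R" using h by (simp_all add: n)
    have "(a \<otimes> t \<oplus> b \<otimes> s) \<otimes> c \<otimes> (s \<otimes> u \<otimes> (t \<otimes> u)) =
        (a \<otimes> c \<otimes> (t \<otimes> u) \<oplus> b \<otimes> c \<otimes> (s \<otimes> u)) \<otimes> (s \<otimes> t \<otimes> u)"
      using h(1,4,7) c by algebra
    then have "fraction R ((a \<otimes> t \<oplus> b \<otimes> s) \<otimes> c) (s \<otimes> t \<otimes> u) =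
        fraction R (a \<otimes> c \<otimes> (t \<otimes> u) \<oplus> b \<otimes> c \<otimes> (s \<otimes> u)) (s \<otimes> u \<otimes> (t \<otimes> u))"
      using h c by (subst fraction_eq_iff) (simp_all add: nzd_mult)
    then show "(p \<oplus>\<^bsub>?Q\<^esub> q) \<otimes>\<^bsub>?Q\<^esub> r = p \<otimes>\<^bsub>?Q\<^esub> r \<oplus>\<^bsub>?Q\<^esub> q \<otimes>\<^bsub>?Q\<^esub> r"
      using h c by (simp only: tq_add tq_mult nzd_mult m_closed a_closed)
  qed
qed

lemma (in cring) tq_embed_ring_hom: "tq_embed R \<in> ring_hom R (total_quotient_ring R)"
proof (rule ring_hom_memI)
  fix x y assume "x \<in> carrier R" "y \<in> carrier R"
  then show "tq_embed R (x \<otimes> y) = tq_embed R x \<otimes>\<^bsub>total_quotient_ring R\<^esub> tq_embed R y"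
    "tq_embed R (x \<oplus> y) = tq_embed R x \<oplus>\<^bsub>total_quotient_ring R\<^esub> tq_embed R y"
    by (simp_all add: tq_embed_def tq_mult tq_add nzd_one)
qed (simp_all add: tq_embed_def tq_one nzd_one fraction_closed)

lemma (in cring) tq_embed_inj: "inj_on (tq_embed R) (carrier R)"
  by (rule inj_onI) (simp add: tq_embed_def fraction_eq_iff nzd_one)

lemma (in cring) tq_fraction:
  assumes "a \<in> carrier R" "s \<in> non_zero_divisors R"
  shows "fraction R a s \<otimes>\<^bsub>total_quotient_ring R\<^esub> tq_embed R s = tq_embed R a"
  using assms by (simp add: tq_embed_def tq_mult nzd_one nzd_mult nzd_closed fraction_eq_iff)


section \<open>Integral elements and integral degree\<close>

text \<open>In what follows \<^term>\<open>K\<close> is (the carrier of) a subring of the ambient ring \<^term>\<open>B\<close>.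
  Coefficient lists start with the leading coefficient, so \<^term>\<open>\<one>\<^bsub>B\<^esub> # cs\<close> is a
  monic polynomial of degree \<^term>\<open>length cs\<close>. This is stated with \<^const>\<open>ring.eval\<close> on the bare
  list rather than with \<^const>\<open>polynomial\<close>, which would demand a nonzero leading
  coefficient and so exclude the zero ring.\<close>

definition monic_equation :: "('a, 'b) ring_scheme \<Rightarrow> 'a set \<Rightarrow> nat \<Rightarrow> 'a \<Rightarrow> bool"
  where "monic_equation B K n b \<longleftrightarrow>
    (\<exists>cs. length cs = n \<and> set cs \<subseteq> K \<and> ring.eval B (\<one>\<^bsub>B\<^esub> # cs) b = \<zero>\<^bsub>B\<^esub>)"

definition integral_over :: "('a, 'b) ring_scheme \<Rightarrow> 'a set \<Rightarrow> 'a \<Rightarrow> bool"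
  where "integral_over B K b \<longleftrightarrow> b \<in> carrier B \<and> (\<exists>n\<ge>1. monic_equation B K n b)"

definition integral_closure :: "('a, 'b) ring_scheme \<Rightarrow> 'a set \<Rightarrow> 'a set"
  where "integral_closure B K = {b. integral_over B K b}"

definition elem_integral_degree :: "('a, 'b) ring_scheme \<Rightarrow> 'a set \<Rightarrow> 'a \<Rightarrow> nat"
  where "elem_integral_degree B K b = (LEAST n. 1 \<le> n \<and> monic_equation B K n b)"

text \<open>The integral degree of the integral extension \<^term>\<open>K \<subseteq> S\<close> of subrings of \<^term>\<open>B\<close>.\<close>

definition ext_integral_degree :: "('a, 'b) ring_scheme \<Rightarrow> 'a set \<Rightarrow> 'a set \<Rightarrow> enat"
  where "ext_integral_degree B K S = (SUP b\<in>S. enat (elem_integral_degree B K b))"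

definition ring_integral_degree :: "('a, 'b) ring_scheme \<Rightarrow> enat"
  where "ring_integral_degree R =
    (let Q = total_quotient_ring R; K = tq_embed R ` carrier R
     in ext_integral_degree Q K (integral_closure Q K))"


section \<open>Rings containing the rationals\<close>

definition rat_ring :: "rat ring"
  where "rat_ring =
    \<lparr> carrier = UNIV, monoid.mult = (*), one = 1, ring.zero = 0, add = (+) \<rparr>"

definition contains_rat :: "('a, 'b) ring_scheme \<Rightarrow> bool"
  where "contains_rat R \<longleftrightarrow> (\<exists>f \<in> ring_hom rat_ring R. inj f)"

end

(*
Write x for a generator of the principal reduction of I(A/a); it is a non zero divisor modulo a.
For y in I the fraction y/x is integral over A/a, so it satisfies a monic equation of degree at most d,
and clearing denominators puts y^d into x I^(d-1) + a. Because A contains the rationals, I^d is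
generated by such d-th powers, hence I^d is contained in x I^(d-1) + a. Multiplying by I^(k+1), an
element of I^(k+1+d) in a has the form x w + v with w in I^(k+d) and v in I^(k+1) (I^d cap a);
regularity of x forces w into a, and induction on k finishes.
*)

theory Submission
  imports Defs
begin

subsection \<open>Powers of ideals\<close>

text \<open>The obstacle is that the degree bound controls one element \<open>y\<close> at a time
  and says nothing about products of different elements of \<open>I\<close>. Polarization bridges
  this: if \<open>y^d\<close> lies in an ideal for every \<open>y\<close> in \<open>I\<close>,
  substituting \<open>y + t z\<close> for \<open>y\<close> with all rational \<open>t\<close> puts
  each coefficient of the resulting polynomial in \<open>t\<close> into that ideal. The coefficient
  of \<open>t\<close> in \<open>(y + t z)^(m+1)\<close> is \<open>(m+1) z y^m\<close>, so one factor
  \<open>y\<close> is traded for an arbitrary \<open>z\<close>; repeating this reaches all of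
  \<open>I^d\<close>. The rationals serve twice, to separate coefficients and to divide by
  \<open>m+1\<close>. Integrality of \<open>y/x\<close> rests on bounded denominators: if the
  reduction satisfies \<open>I^(m+1) = x I^m\<close>, then \<open>x^m y^k\<close> lies in
  \<open>I^(m+k)\<close> and so is divisible by \<open>x^k\<close>; hence every power of
  \<open>y/x\<close> lies in \<open>x^(-m) R\<close>. An integral equation of degree
  \<open>n\<close> for \<open>y/x\<close> is equivalent to \<open>y^n + x f = 0\<close> in the base
  ring, with \<open>f\<close> a binary form of degree \<open>n-1\<close> in \<open>y\<close> and
  \<open>x\<close>. In this shape it lifts from the quotient to \<open>A\<close>, with an error in
  the ideal \<open>\<aa>\<close>.\<close>

lemma ideal_pow_0 [simp]: "ideal_pow R I 0 = carrier R"
  by (simp add: ideal_pow_def ideals_set_def)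

lemma ideal_pow_Suc: "ideal_pow R I (Suc n) = ideal_prod R (ideal_pow R I n) I"
  by (simp add: ideal_pow_def ideals_set_def nat_pow_def)

lemma (in cring) ideal_pow_ideal: "ideal I R \<Longrightarrow> ideal (ideal_pow R I n) R"
  by (induction n) (simp_all add: oneideal ideal_pow_Suc ideal_prod_is_ideal)

lemma (in cring) ideal_pow_add:
  assumes "ideal I R"
  shows "ideal_prod R (ideal_pow R I m) (ideal_pow R I n) = ideal_pow R I (m + n)"
proof -
  interpret IS: comm_monoid "ideals_set R" by (rule ideals_set_is_comm_monoid)
  show ?thesis
    using IS.nat_pow_mult[of I m n] assms by (simp add: ideal_pow_def ideals_set_def)
qed

lemma (in cring) pow_mem_ideal_pow:
  assumes "ideal I R" "y \<in> I"
  shows "y [^] n \<in> ideal_pow R I n"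
  using assms by (induction n) (auto simp: ideal_pow_Suc intro: ideal_prod.prod)

lemma ideal_prod_mono:
  assumes "I \<subseteq> I'" "J \<subseteq> J'"
  shows "ideal_prod R I J \<subseteq> ideal_prod R I' J'"
proof
  fix s assume "s \<in> ideal_prod R I J"
  then show "s \<in> ideal_prod R I' J'"
    using assms by (induction rule: ideal_prod.induct) (auto intro: ideal_prod.intros)
qed


subsection \<open>Polarization over the rationals\<close>

locale rat_cring = cring +
  fixes \<iota> :: "rat \<Rightarrow> 'a"
  assumes rat_hom: "\<iota> \<in> ring_hom rat_ring R"
begin

lemma rat_closed [simp]: "\<iota> q \<in> carrier R"
  and rat_mult: "\<iota> (p * q) = \<iota> p \<otimes> \<iota> q"
  and rat_add: "\<iota> (p + q) = \<iota> p \<oplus> \<iota> q"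
  and rat_one: "\<iota> 1 = \<one>"
  using rat_hom by (auto simp: ring_hom_def rat_ring_def)

lemma rat_zero: "\<iota> 0 = \<zero>"
  using rat_add[of 0 0] by (metis rat_closed add.l_cancel_one' add_0)

lemma rat_diff: "\<iota> (p - q) = \<iota> p \<ominus> \<iota> q"
proof -
  have "\<iota> p = \<iota> (p - q) \<oplus> \<iota> q" by (simp flip: rat_add)
  then have "\<iota> p \<ominus> \<iota> q = (\<iota> (p - q) \<oplus> \<iota> q) \<ominus> \<iota> q" by simp
  also have "\<dots> = \<iota> (p - q)" by (simp add: a_assoc minus_eq r_neg)
  finally show ?thesis ..
qed

text \<open>The image of a nonzero rational is a unit, with inverse
  \<open>\<iota> (inverse q)\<close>.\<close>

lemma ideal_rat_cancel:
  assumes "ideal J R" "c \<in> carrier R" "\<iota> q \<otimes> c \<in> J" "q \<noteq> 0"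
  shows "c \<in> J"
proof -
  interpret J: ideal J R by fact
  have "\<iota> (inverse q) \<otimes> (\<iota> q \<otimes> c) \<in> J" using assms(3) by (simp add: J.I_l_closed)
  also have "\<iota> (inverse q) \<otimes> (\<iota> q \<otimes> c) = \<iota> (inverse q * q) \<otimes> c"
    using assms(2) by (simp add: rat_mult m_assoc)
  finally show ?thesis using assms(2,4) by (simp add: rat_one)
qed

text \<open>Doubling the variable multiplies the \<open>i\<close>-th coefficient by
  \<open>2^i\<close>, so subtracting \<open>k\<close> times the original polynomial leaves the
  factor \<open>2^i - k\<close>. The choice \<open>k = 2^n\<close> removes the term of degree
  \<open>n\<close>.\<close>

lemma finsum_rat_diff:
  assumes c: "c \<in> UNIV \<rightarrow> carrier R"
  shows "(\<Oplus>i\<in>{..n::nat}. \<iota> ((2 * t) ^ i) \<otimes> c i) \<ominus> \<iota> k \<otimes> (\<Oplus>i\<in>{..n}. \<iota> (t ^ i) \<otimes> c i) =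
    (\<Oplus>i\<in>{..n}. \<iota> (t ^ i) \<otimes> (\<iota> (2 ^ i - k) \<otimes> c i))"
proof -
  have ci [simp]: "c i \<in> carrier R" for i using c by auto
  show ?thesis
  proof (induction n)
    case 0
    have "\<one> \<otimes> c 0 \<ominus> \<iota> k \<otimes> (\<one> \<otimes> c 0) = \<one> \<otimes> ((\<one> \<ominus> \<iota> k) \<otimes> c 0)"
      using ci[of 0] rat_closed[of k] by algebra
    then show ?case by (simp add: rat_one rat_diff)
  next
    case (Suc n)
    define a b where "a = (\<Oplus>i\<in>{..n}. \<iota> ((2 * t) ^ i) \<otimes> c i)"
      and "b = (\<Oplus>i\<in>{..n}. \<iota> (t ^ i) \<otimes> c i)"
    have ab: "a \<in> carrier R" "b \<in> carrier R" unfolding a_def b_def by auto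
    define u v where "u = \<iota> (2 ^ Suc n)" and "v = \<iota> (t ^ Suc n)"
    have uv: "u \<in> carrier R" "v \<in> carrier R" unfolding u_def v_def by auto
    have w: "\<iota> ((2 * t) ^ Suc n) = u \<otimes> v" unfolding u_def v_def
      by (simp flip: rat_mult add: power_mult_distrib mult_ac)
    have "(u \<otimes> v \<otimes> c (Suc n) \<oplus> a) \<ominus> \<iota> k \<otimes> (v \<otimes> c (Suc n) \<oplus> b) =
      v \<otimes> ((u \<ominus> \<iota> k) \<otimes> c (Suc n)) \<oplus> (a \<ominus> \<iota> k \<otimes> b)"
      using ab uv ci[of "Suc n"] rat_closed[of k] by algebra
    moreover have "(\<Oplus>i\<in>{..Suc n}. \<iota> ((2 * t) ^ i) \<otimes> c i) = u \<otimes> v \<otimes> c (Suc n) \<oplus> a"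
      using finsum_Suc[of "\<lambda>i. \<iota> ((2 * t) ^ i) \<otimes> c i" n]
      unfolding w a_def[symmetric] by (simp add: Pi_iff)
    moreover have "(\<Oplus>i\<in>{..Suc n}. \<iota> (t ^ i) \<otimes> c i) = v \<otimes> c (Suc n) \<oplus> b"
      by (subst finsum_Suc) (simp_all add: v_def b_def)
    moreover have "(\<Oplus>i\<in>{..Suc n}. \<iota> (t ^ i) \<otimes> (\<iota> (2 ^ i - k) \<otimes> c i)) =
        v \<otimes> ((u \<ominus> \<iota> k) \<otimes> c (Suc n)) \<oplus> (a \<ominus> \<iota> k \<otimes> b)"
      unfolding Suc.IH[folded a_def b_def]
      by (subst finsum_Suc) (simp_all add: u_def v_def rat_diff)
    ultimately show ?case by (simp only:)
  qed
qed

text \<open>Passing from \<open>g t\<close> to \<open>g (2 * t) - 2 ^ n * g t\<close> kills the leading coefficient.\<close>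

lemma coeffs_mem_ideal:
  assumes "ideal J R" "c \<in> UNIV \<rightarrow> carrier R"
    and "\<And>t. (\<Oplus>i\<in>{..n::nat}. \<iota> (t ^ i) \<otimes> c i) \<in> J" and "i \<le> n"
  shows "c i \<in> J"
  using assms(2-)
proof (induction n arbitrary: c i)
  case 0
  have "c 0 \<in> carrier R" using 0 by auto
  then show ?case using 0(2)[of 1] 0(3) by (simp add: rat_one)
next
  case (Suc n)
  interpret J: ideal J R by fact
  have ci [simp]: "c i \<in> carrier R" for i using Suc.prems by auto
  define g where "g t = (\<Oplus>i\<in>{..Suc n}. \<iota> (t ^ i) \<otimes> c i)" for t
  have "(\<Oplus>i\<in>{..n}. \<iota> (t ^ i) \<otimes> (\<iota> (2 ^ i - 2 ^ Suc n) \<otimes> c i)) \<in> J" for t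
  proof -
    have "g (2 * t) \<in> J" "\<iota> (2 ^ Suc n) \<otimes> g t \<in> J"
      unfolding g_def by (rule Suc.prems(2), intro J.I_l_closed Suc.prems(2) rat_closed)
    then have "g (2 * t) \<ominus> \<iota> (2 ^ Suc n) \<otimes> g t \<in> J"
      by (simp add: minus_eq)
    moreover have "g (2 * t) \<ominus> \<iota> (2 ^ Suc n) \<otimes> g t =
      (\<Oplus>i\<in>{..Suc n}. \<iota> (t ^ i) \<otimes> (\<iota> (2 ^ i - 2 ^ Suc n) \<otimes> c i))"
      unfolding g_def by (rule finsum_rat_diff) simp
    moreover have "\<dots> = (\<Oplus>i\<in>{..n}. \<iota> (t ^ i) \<otimes> (\<iota> (2 ^ i - 2 ^ Suc n) \<otimes> c i))"
      by (simp add: finsum_Suc rat_zero)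
    ultimately show ?thesis by simp
  qed
  \<comment> \<open>The induction hypothesis is used for the rescaled coefficients; the factors
    \<open>2^i - 2^Suc n\<close> with \<open>i \<le> n\<close> are nonzero rationals and can be
    divided out.\<close>
  then have "\<iota> (2 ^ i - 2 ^ Suc n) \<otimes> c i \<in> J" if "i \<le> n" for i
    using Suc.IH[of "\<lambda>i. \<iota> (2 ^ i - 2 ^ Suc n) \<otimes> c i" i] that by simp
  moreover have "(2::rat) ^ i - 2 ^ Suc n \<noteq> 0" if "i \<le> n" for i
    using that power_strict_increasing[of i "Suc n" "2::rat"] by simp
  ultimately have low: "c i \<in> J" if "i \<le> n" for i
    using ideal_rat_cancel[OF assms(1) ci] that by blast
  have "finsum R c {..n} \<in> J"
    if "\<And>i. i \<le> n \<Longrightarrow> c i \<in> J" for n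
    using that by (induction n) (simp_all add: finsum_Suc)
  then have s: "finsum R c {..n} \<in> J" using low by simp
  \<comment> \<open>At \<open>t = 1\<close> the value is the sum of all coefficients, which isolates
    the leading one once the lower ones are known to lie in \<open>J\<close>.\<close>
  have "c (Suc n) \<oplus> finsum R c {..n} \<in> J"
    using Suc.prems(2)[of 1] by (simp add: finsum_Suc rat_one)
  then have "(c (Suc n) \<oplus> finsum R c {..n}) \<ominus> finsum R c {..n} \<in> J"
    using s by (simp add: minus_eq)
  moreover have "(c (Suc n) \<oplus> finsum R c {..n}) \<ominus> finsum R c {..n} = c (Suc n)"
    using s J.Icarr by (simp add: minus_eq a_assoc r_neg)
  ultimately show ?case using low Suc.prems(3) by (cases "i = Suc n") auto
qed

text \<open>Polarization reads off only the linear coefficient; the constant one is recorded because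
  the recursion for \<open>c 1\<close> involves it. The expansion is claimed for every upper bound
  \<open>n \<ge> m\<close>, since the inductive step compares sums truncated at two different
  places. For \<open>m = 0\<close> the truncated exponent \<open>m - 1\<close> is harmless, because
  the factor \<open>\<iota> (of_nat 0)\<close> vanishes.\<close>

lemma binomial_first_coeffs:
  assumes y: "y \<in> carrier R" and z: "z \<in> carrier R"
  shows "\<exists>c \<in> UNIV \<rightarrow> carrier R. c 0 = y [^] m \<and>
    c 1 = \<iota> (of_nat m) \<otimes> (z \<otimes> y [^] (m - 1)) \<and>
    (\<forall>n\<ge>m. \<forall>t. (y \<oplus> \<iota> t \<otimes> z) [^] m = (\<Oplus>i\<in>{..n}. \<iota> (t ^ i) \<otimes> c i))"
proof (induction m)
  case 0
  define c where "c i = (if i = 0 then \<one> else \<zero>)" for i :: nat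
  have "(\<Oplus>i\<in>{..n}. \<iota> (t ^ i) \<otimes> c i) = \<one>" for n t
    by (induction n) (simp_all add: c_def rat_one finsum_Suc)
  then show ?case
    using y z by (intro bexI[of _ c]) (auto simp: c_def rat_zero)
next
  case (Suc m)
  then obtain c where c: "c \<in> UNIV \<rightarrow> carrier R" and c0: "c 0 = y [^] m"
    and c1: "c 1 = \<iota> (of_nat m) \<otimes> (z \<otimes> y [^] (m - 1))"
    and pow: "\<And>n t. n \<ge> m \<Longrightarrow> (y \<oplus> \<iota> t \<otimes> z) [^] m = (\<Oplus>i\<in>{..n}. \<iota> (t ^ i) \<otimes> c i)"
    by auto
  have ci [simp]: "c i \<in> carrier R" for i using c by auto
  \<comment> \<open>Pascal's rule: these are the coefficients of \<open>y + t z\<close> times the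
    polynomial with coefficients \<open>c\<close>.\<close>
  define e where "e i = (case i of 0 \<Rightarrow> y \<otimes> c 0 | Suc j \<Rightarrow> y \<otimes> c (Suc j) \<oplus> z \<otimes> c j)" for i
  have e: "e \<in> UNIV \<rightarrow> carrier R"
    using y z by (auto simp: e_def split: nat.split)
  have e1: "e 1 = \<iota> (of_nat (Suc m)) \<otimes> (z \<otimes> y [^] m)"
  proof (cases m)
    case 0
    then show ?thesis using c0 c1 y z by (simp add: e_def rat_zero rat_one)
  next
    case (Suc k)
    have p: "y [^] k \<in> carrier R" using y by simp
    have "e 1 = y \<otimes> (\<iota> (of_nat m) \<otimes> (z \<otimes> y [^] k)) \<oplus> z \<otimes> (y [^] k \<otimes> y)"
      using c0 c1 Suc by (simp add: e_def)
    also have "\<dots> = (\<one> \<oplus> \<iota> (of_nat m)) \<otimes> (z \<otimes> (y [^] k \<otimes> y))"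
      using y z p rat_closed[of "of_nat m"] by algebra
    also have "\<one> \<oplus> \<iota> (of_nat m) = \<iota> (of_nat (Suc m))"
      by (simp add: rat_add rat_one)
    also have "y [^] k \<otimes> y = y [^] m" using Suc by simp
    finally show ?thesis .
  qed
  have "(y \<oplus> \<iota> t \<otimes> z) [^] Suc m = (\<Oplus>i\<in>{..Suc n}. \<iota> (t ^ i) \<otimes> e i)" if "n \<ge> m" for n t
  proof -
    \<comment> \<open>Multiplication by \<open>t z\<close> shifts indices, so the two sums on the
      right end at \<open>Suc k\<close> and at \<open>k\<close>. For \<open>k = n \<ge> m\<close>
      both equal the same power \<open>(y + t z)^m\<close>.\<close>
    have split: "(\<Oplus>i\<in>{..Suc k}. \<iota> (t ^ i) \<otimes> e i) =
      y \<otimes> (\<Oplus>i\<in>{..Suc k}. \<iota> (t ^ i) \<otimes> c i) \<oplus> \<iota> t \<otimes> z \<otimes> (\<Oplus>i\<in>{..k}. \<iota> (t ^ i) \<otimes> c i)" for k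
    proof (induction k)
      case 0
      have "\<iota> t \<otimes> (y \<otimes> c 1 \<oplus> z \<otimes> c 0) \<oplus> \<one> \<otimes> (y \<otimes> c 0) =
          y \<otimes> (\<iota> t \<otimes> c 1 \<oplus> \<one> \<otimes> c 0) \<oplus> \<iota> t \<otimes> z \<otimes> (\<one> \<otimes> c 0)"
        using y z ci[of 0] ci[of 1] rat_closed[of t] by algebra
      moreover have "(\<Oplus>i\<in>{..Suc 0}. \<iota> (t ^ i) \<otimes> e i) = \<iota> t \<otimes> e 1 \<oplus> \<one> \<otimes> e 0"
        using e by (simp add: finsum_Suc rat_one Pi_iff)
      ultimately show ?case by (simp add: finsum_Suc e_def rat_one)
    next
      case (Suc k)
      define a b where "a = (\<Oplus>i\<in>{..Suc k}. \<iota> (t ^ i) \<otimes> c i)"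
        and "b = (\<Oplus>i\<in>{..k}. \<iota> (t ^ i) \<otimes> c i)"
      have ab: "a \<in> carrier R" "b \<in> carrier R" unfolding a_def b_def by auto
      define u where "u = \<iota> (t ^ Suc k)"
      have u: "u \<in> carrier R" unfolding u_def by simp
      have t2: "\<iota> (t ^ Suc (Suc k)) = \<iota> t \<otimes> u" unfolding u_def
        by (simp flip: rat_mult)
      have a': "a = u \<otimes> c (Suc k) \<oplus> b" unfolding a_def b_def u_def by (simp add: finsum_Suc del: power_Suc)
      have "(\<Oplus>i\<in>{..Suc (Suc k)}. \<iota> (t ^ i) \<otimes> e i) =
        \<iota> t \<otimes> u \<otimes> e (Suc (Suc k)) \<oplus> (y \<otimes> a \<oplus> \<iota> t \<otimes> z \<otimes> b)"
        using finsum_Suc[of "\<lambda>i. \<iota> (t ^ i) \<otimes> e i" "Suc k"] e Suc.IH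
        unfolding a_def[symmetric] b_def[symmetric] t2 by (simp add: Pi_iff)
      also have "\<dots> = y \<otimes> (\<iota> t \<otimes> u \<otimes> c (Suc (Suc k)) \<oplus> a) \<oplus> \<iota> t \<otimes> z \<otimes> (u \<otimes> c (Suc k) \<oplus> b)"
        unfolding e_def nat.case
        using y z ab u ci[of "Suc k"] ci[of "Suc (Suc k)"] rat_closed[of t] by algebra
      also have "\<iota> t \<otimes> u \<otimes> c (Suc (Suc k)) \<oplus> a = (\<Oplus>i\<in>{..Suc (Suc k)}. \<iota> (t ^ i) \<otimes> c i)"
        using finsum_Suc[of "\<lambda>i. \<iota> (t ^ i) \<otimes> c i" "Suc k"]
        unfolding a_def[symmetric] t2 by (simp add: Pi_iff)
      finally show ?case unfolding a'[symmetric] a_def .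
    qed
    define P where "P = (y \<oplus> \<iota> t \<otimes> z) [^] m"
    have "P \<in> carrier R" using y z by (simp add: P_def)
    then have "P \<otimes> (y \<oplus> \<iota> t \<otimes> z) = y \<otimes> P \<oplus> \<iota> t \<otimes> z \<otimes> P"
      using y z rat_closed[of t] by algebra
    then show ?thesis
      unfolding split using pow[OF that, of t] pow[of "Suc n" t] that by (simp add: P_def)
  qed
  then have "(y \<oplus> \<iota> t \<otimes> z) [^] Suc m = (\<Oplus>i\<in>{..n}. \<iota> (t ^ i) \<otimes> e i)" if "n \<ge> Suc m" for n t
    using that by (metis Suc_le_D Suc_le_mono)
  then show ?case
    using e e1 c0 y by (intro bexI[of _ e]) (auto simp: e_def m_comm)
qed

text \<open>All coefficients of \<open>w (y + t z)^(m+1)\<close> as a polynomial in \<open>t\<close>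
  lie in \<open>J\<close>; the linear one is \<open>(m+1) w z y^m\<close>, and \<open>m+1\<close> is
  invertible.\<close>

lemma linear_coeff_mem_ideal:
  assumes J: "ideal J R" and carr: "w \<in> carrier R" "y \<in> carrier R" "z \<in> carrier R"
    and mem: "\<And>t. w \<otimes> (y \<oplus> \<iota> t \<otimes> z) [^] Suc m \<in> J"
  shows "w \<otimes> z \<otimes> y [^] m \<in> J"
proof -
  obtain c where c: "c \<in> UNIV \<rightarrow> carrier R"
    and c1: "c 1 = \<iota> (of_nat (Suc m)) \<otimes> (z \<otimes> y [^] m)"
    and pow: "\<And>t. (y \<oplus> \<iota> t \<otimes> z) [^] Suc m = (\<Oplus>i\<in>{..Suc m}. \<iota> (t ^ i) \<otimes> c i)"
    using binomial_first_coeffs[OF carr(2,3), of "Suc m"] by auto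
  have ci [simp]: "c i \<in> carrier R" for i using c by auto
  have "(\<Oplus>i\<in>{..Suc m}. \<iota> (t ^ i) \<otimes> (w \<otimes> c i)) = w \<otimes> (\<Oplus>i\<in>{..Suc m}. \<iota> (t ^ i) \<otimes> c i)" for t
    using carr(1) by (subst finsum_rdistr) (auto simp: m_lcomm intro!: finsum_cong)
  then have "(\<Oplus>i\<in>{..Suc m}. \<iota> (t ^ i) \<otimes> (w \<otimes> c i)) \<in> J" for t
    using mem[of t] pow[of t] by simp
  then have "w \<otimes> c 1 \<in> J"
    using coeffs_mem_ideal[OF J, of "\<lambda>i. w \<otimes> c i" "Suc m" 1] carr(1) by simp
  moreover have "w \<otimes> c 1 = \<iota> (of_nat (Suc m)) \<otimes> (w \<otimes> z \<otimes> y [^] m)"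
    unfolding c1 using carr by (simp add: m_ac)
  ultimately show ?thesis
    using ideal_rat_cancel[OF J, of "w \<otimes> z \<otimes> y [^] m" "of_nat (Suc m)"] carr by simp
qed

text \<open>The factors \<open>y\<close> of \<open>y^d\<close> are exchanged one at a time: by
  induction on \<open>j\<close>, the products of \<open>I^j\<close> with \<open>y^(d-j)\<close> lie
  in \<open>J\<close>, and at \<open>j = d\<close> no \<open>y\<close> is left.\<close>

lemma ideal_pow_subset:
  assumes I: "ideal I R" and J: "ideal J R" and pow: "\<And>y. y \<in> I \<Longrightarrow> y [^] d \<in> J"
  shows "ideal_pow R I d \<subseteq> J"
proof -
  interpret I: ideal I R by fact
  interpret J: ideal J R by fact
  have "w \<otimes> y [^] (d - j) \<in> J" if "j \<le> d" "w \<in> ideal_pow R I j" "y \<in> I" for j w y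
    using that
  proof (induction j arbitrary: w y)
    case 0
    then show ?case using pow by (simp add: J.I_l_closed)
  next
    case (Suc j)
    have P: "ideal (ideal_pow R I j) R" using I by (rule ideal_pow_ideal)
    have "w \<in> carrier R \<and> w \<otimes> y [^] (d - Suc j) \<in> J"
      using Suc.prems(2) unfolding ideal_pow_Suc
    proof (induction rule: ideal_prod.induct)
      case (prod v z)
      have c: "v \<in> carrier R" "z \<in> carrier R" "y \<in> carrier R"
        using prod Suc.prems P ideal.Icarr I.Icarr by metis+
      \<comment> \<open>The exponent is \<open>d - j\<close>, and \<open>y + t z\<close> is again an
        element of \<open>I\<close>; this is why the induction on \<open>j\<close> keeps
        \<open>y\<close> arbitrary.\<close>
      have "v \<otimes> (y \<oplus> \<iota> t \<otimes> z) [^] Suc (d - Suc j) \<in> J" for t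
        using Suc.IH[of v "y \<oplus> \<iota> t \<otimes> z"] prod Suc.prems
        by (simp add: I.I_l_closed Suc_diff_Suc del: nat_pow_Suc)
      then show ?case using linear_coeff_mem_ideal[OF J c(1,3,2)] c by simp
    next
      case (sum s s')
      then show ?case using Suc.prems I.Icarr by (simp add: l_distr)
    qed
    then show ?case ..
  qed
  \<comment> \<open>The remaining power has exponent 0, so any element of \<open>I\<close> may stand
    for \<open>y\<close>.\<close>
  from this[of d _ \<zero>] show ?thesis
    using ideal.Icarr[OF ideal_pow_ideal[OF I]] by auto
qed

end


subsection \<open>Noetherian rings\<close>

lemma (in noetherian_ring) ideal_chain_stabilizes:
  assumes "\<And>n. ideal (K n) R" and mono: "\<And>n. K n \<subseteq> K (Suc n)"
  shows "\<exists>n. K (Suc n) = K n"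
proof -
  have "mono K" using mono by (simp add: mono_iff_le_Suc)
  then have "K i \<subseteq> K j \<or> K j \<subseteq> K i" for i j
    using \<open>mono K\<close> nat_le_linear[of i j] by (auto dest: monoD)
  then have "subset.chain {I. ideal I R} (range K)"
    using assms(1) unfolding pred_on.chain_def by blast
  then obtain n where "\<Union> (range K) = K n"
    using ideal_chain_is_trivial[of "range K"] by blast
  then show ?thesis using mono[of n] by blast
qed

text \<open>Finitely many generators of the preimage of \<open>K\<close> map to generators of
  \<open>K\<close>.\<close>

lemma (in ring_hom_ring) noetherian_ring_image:
  assumes "noetherian_ring R" "h ` carrier R = carrier S"
  shows "noetherian_ring S"
proof (rule S.noetherian_ringI)
  interpret N: noetherian_ring R by fact
  fix K assume K: "ideal K S"
  interpret K: ideal K S by fact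
  obtain T where T: "T \<subseteq> carrier R" "finite T" "{r \<in> carrier R. h r \<in> K} = Idl\<^bsub>R\<^esub> T"
    using N.finetely_gen[OF ideal_vimage[OF K]] by blast
  have hX: "h ` T \<subseteq> carrier S" using T by auto
  have "T \<subseteq> {r \<in> carrier R. h r \<in> K}" using R.genideal_self[OF T(1)] T(3) by simp
  then have "Idl\<^bsub>S\<^esub> (h ` T) \<subseteq> K"
    by (intro S.genideal_minimal[OF K]) auto
  moreover have "Idl\<^bsub>R\<^esub> T \<subseteq> {r \<in> carrier R. h r \<in> Idl\<^bsub>S\<^esub> (h ` T)}"
    using T(1) S.genideal_self[OF hX]
    by (intro R.genideal_minimal ideal_vimage S.genideal_ideal hX) auto
  then have "h r \<in> Idl\<^bsub>S\<^esub> (h ` T)" if "r \<in> carrier R" "h r \<in> K" for r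
    using that T(3) by blast
  then have "K \<subseteq> Idl\<^bsub>S\<^esub> (h ` T)"
    using K.a_subset unfolding assms(2)[symmetric] by blast
  ultimately show "\<exists>Y\<subseteq>carrier S. finite Y \<and> K = Idl\<^bsub>S\<^esub> Y"
    using hX T(2) by blast
qed

text \<open>The head of the list multiplies the member of highest index, so
  \<open>[c1, ..., cn]\<close> gives \<open>c1 u(n-1) + ... + cn u(0)\<close>. This is the
  leading-coefficient-first order of \<open>bin_form\<close> and of polynomial evaluation.\<close>

fun lin_comb :: "('a, 'b) ring_scheme \<Rightarrow> (nat \<Rightarrow> 'a) \<Rightarrow> 'a list \<Rightarrow> 'a"
  where "lin_comb R u [] = \<zero>\<^bsub>R\<^esub>"
  | "lin_comb R u (c # cs) = c \<otimes>\<^bsub>R\<^esub> u (length cs) \<oplus>\<^bsub>R\<^esub> lin_comb R u cs"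

lemma (in cring) lin_comb_closed:
  "set cs \<subseteq> carrier R \<Longrightarrow> (\<And>n. u n \<in> carrier R) \<Longrightarrow> lin_comb R u cs \<in> carrier R"
  by (induction cs) auto

text \<open>The ideals generated by \<open>u 0, ..., u (n-1)\<close> increase with \<open>n\<close>.
  Where the chain repeats itself, \<open>u n\<close> is a combination of its predecessors;
  \<open>n = 0\<close> can occur and then says \<open>u 0 = \<zero>\<close>.\<close>

lemma (in cring) noetherian_lin_comb:
  assumes "noetherian_ring R" and u: "\<And>n. u n \<in> carrier R"
  shows "\<exists>cs. set cs \<subseteq> carrier R \<and> u (length cs) = lin_comb R u cs"
proof -
  interpret noetherian_ring R by fact
  define K where "K = rec_nat {\<zero>} (\<lambda>n L. PIdl (u n) <+> L)"
  have K: "K 0 = {\<zero>}" "K (Suc n) = PIdl (u n) <+> K n" for n by (simp_all add: K_def)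
  have Kid: "ideal (K n) R" for n
    by (induction n) (simp_all add: K zeroideal add_ideals cgenideal_ideal u)
  have "K n \<subseteq> K (Suc n)" for n
  proof
    fix k assume k: "k \<in> K n"
    have "\<zero> \<oplus> k \<in> K (Suc n)"
      unfolding K set_add_def'
      using k additive_subgroup.zero_closed[OF ideal.axioms(1)[OF cgenideal_ideal[OF u]]] by blast
    then show "k \<in> K (Suc n)" using k ideal.Icarr[OF Kid] by simp
  qed
  then obtain n where n: "K (Suc n) = K n" using ideal_chain_stabilizes[of K] Kid by blast
  have "u n \<oplus> \<zero> \<in> K (Suc n)"
    unfolding K set_add_def'
    using cgenideal_self[OF u] additive_subgroup.zero_closed[OF ideal.axioms(1)[OF Kid]] by blast
  then have un: "u n \<in> K n" using n u by simp
  have "\<exists>cs. length cs = n \<and> set cs \<subseteq> carrier R \<and> k = lin_comb R u cs" if "k \<in> K n" for n k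
    using that
  proof (induction n arbitrary: k)
    case 0
    then show ?case by (simp add: K)
  next
    case (Suc n)
    then obtain c l where c: "c \<in> carrier R" "l \<in> K n" "k = c \<otimes> u n \<oplus> l"
      unfolding K set_add_def' cgenideal_def by auto
    then obtain cs where "length cs = n" "set cs \<subseteq> carrier R" "l = lin_comb R u cs"
      using Suc.IH by blast
    then show ?case using c by (intro exI[of _ "c # cs"]) auto
  qed
  then show ?thesis using un by blast
qed


subsection \<open>Fractions integral over the base ring\<close>

text \<open>\<open>cs = [c\<^sub>1, \<dots>, c\<^sub>n]\<close> encodes the binary form
  \<open>c\<^sub>1 y ^ (n - 1) + c\<^sub>2 x y ^ (n - 2) + \<dots> + c\<^sub>n x ^ (n - 1)\<close>.\<close>

fun bin_form :: "('a, 'b) ring_scheme \<Rightarrow> 'a \<Rightarrow> 'a \<Rightarrow> 'a list \<Rightarrow> 'a"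
  where "bin_form R y x [] = \<zero>\<^bsub>R\<^esub>"
  | "bin_form R y x (c # cs) = c \<otimes>\<^bsub>R\<^esub> y [^]\<^bsub>R\<^esub> length cs \<oplus>\<^bsub>R\<^esub> x \<otimes>\<^bsub>R\<^esub> bin_form R y x cs"

lemma (in cring) bin_form_closed [simp]:
  "\<lbrakk>set cs \<subseteq> carrier R; y \<in> carrier R; x \<in> carrier R\<rbrakk> \<Longrightarrow> bin_form R y x cs \<in> carrier R"
  by (induction cs) auto

lemma (in ring_hom_ring) hom_bin_form:
  assumes "cring R" "set cs \<subseteq> carrier R" "y \<in> carrier R" "x \<in> carrier R"
  shows "h (bin_form R y x cs) = bin_form S (h y) (h x) (map h cs)"
  using assms(2-) by (induction cs) (auto simp: hom_nat_pow cring.bin_form_closed[OF assms(1)])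

text \<open>Each monomial of the form has total degree \<open>length cs - 1\<close> in
  \<open>x\<close> and \<open>y\<close>, both of which lie in \<open>I\<close>.\<close>

lemma (in cring) bin_form_mem_ideal_pow:
  assumes I: "ideal I R" and "x \<in> I" "y \<in> I" "set cs \<subseteq> carrier R" "cs \<noteq> []"
  shows "bin_form R y x cs \<in> ideal_pow R I (length cs - 1)"
  using assms(4,5)
proof (induction cs)
  case (Cons c cs)
  interpret P: ideal "ideal_pow R I (length cs)" R using I by (rule ideal_pow_ideal)
  have "x \<otimes> bin_form R y x cs \<in> ideal_pow R I (length cs)"
  proof (cases "cs = []")
    case True
    then show ?thesis using assms(2) ideal.Icarr[OF I] by simp
  next
    case False
    then have "bin_form R y x cs \<otimes> x \<in> ideal_pow R I (Suc (length cs - 1))"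
      unfolding ideal_pow_Suc using Cons assms(2) by (intro ideal_prod.prod) auto
    moreover have "bin_form R y x cs \<in> carrier R" "x \<in> carrier R"
      using Cons.prems assms ideal.Icarr[OF I] by auto
    ultimately show ?thesis using False by (simp add: m_comm)
  qed
  then show ?case
    using Cons.prems pow_mem_ideal_pow[OF I assms(3)] by (simp add: P.I_l_closed)
qed simp

lemma (in cring) nzd_pow: "s \<in> non_zero_divisors R \<Longrightarrow> s [^] (n::nat) \<in> non_zero_divisors R"
  by (induction n) (auto simp: nzd_one nzd_mult)

lemma (in cring) nzd_mult_eq_zero_iff:
  assumes "s \<in> non_zero_divisors R" "a \<in> carrier R"
  shows "a \<otimes> s = \<zero> \<longleftrightarrow> a = \<zero>"
  using assms nzd_closed[OF assms(1)] nzd_cancel[OF assms(1,2) zero_closed] by (auto simp: m_comm)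

lemma (in cring) tq_embed_ring_hom_cring:
  "ring_hom_cring R (total_quotient_ring R) (tq_embed R)"
  using tq_is_cring tq_embed_ring_hom
  by (metis is_cring cring.axioms(1) ring_hom_cringI ring_hom_ringI2)

lemma (in cring) tq_embed_nzd:
  assumes "x \<in> non_zero_divisors R"
  shows "tq_embed R x \<in> non_zero_divisors (total_quotient_ring R)"
proof -
  let ?Q = "total_quotient_ring R"
  have "p = \<zero>\<^bsub>?Q\<^esub>" if p: "p \<in> carrier ?Q" and z: "tq_embed R x \<otimes>\<^bsub>?Q\<^esub> p = \<zero>\<^bsub>?Q\<^esub>" for p
  proof -
    obtain a s where as: "a \<in> carrier R" "s \<in> non_zero_divisors R" "p = fraction R a s"
      using p by (rule tq_cases)
    then have "x \<otimes> a = \<zero>"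
      using z assms by (simp add: tq_embed_def tq_mult tq_zero nzd_one nzd_mult nzd_closed fraction_eq_iff)
    then have "a = \<zero>" using assms as(1) by (simp add: non_zero_divisors_def)
    then show ?thesis using as by (simp add: tq_zero fraction_eq_iff nzd_one nzd_closed)
  qed
  then show ?thesis
    using assms by (auto simp: non_zero_divisors_def tq_embed_def nzd_one fraction_closed)
qed

text \<open>Clears denominators in a polynomial with \<open>length cs\<close> coefficients. Its
  degree is at most \<open>length cs - 1\<close>, so multiplying by \<open>x^(length cs)\<close>
  leaves a surplus factor \<open>x\<close>; keeping it avoids a truncated exponent and covers the
  empty list.\<close>

lemma (in cring) eval_fraction:
  assumes x: "x \<in> non_zero_divisors R" and y: "y \<in> carrier R" and "set cs \<subseteq> carrier R"
  defines "Q \<equiv> total_quotient_ring R"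
  shows "ring.eval Q (map (tq_embed R) cs) (fraction R y x) \<otimes>\<^bsub>Q\<^esub> tq_embed R x [^]\<^bsub>Q\<^esub> length cs =
    tq_embed R (x \<otimes> bin_form R y x cs)"
  using assms(3)
proof (induction cs)
  interpret Q: cring Q unfolding Q_def by (rule tq_is_cring)
  interpret e: ring_hom_cring R Q "tq_embed R"
    unfolding Q_def by (rule tq_embed_ring_hom_cring)
  have xc [simp]: "x \<in> carrier R" using x by (rule nzd_closed)
  have bc [simp]: "fraction R y x \<in> carrier Q" unfolding Q_def using x y by (intro fraction_closed)
  {
    case Nil
    show ?case by simp
  next
    case (Cons c cs)
    define b p v where "b = fraction R y x [^]\<^bsub>Q\<^esub> length cs"
      and "p = ring.eval Q (map (tq_embed R) cs) (fraction R y x)"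
      and "v = tq_embed R x [^]\<^bsub>Q\<^esub> length cs"
    have cl: "b \<in> carrier Q" "p \<in> carrier Q" "v \<in> carrier Q"
      using Cons.prems unfolding b_def p_def v_def by (auto simp: subset_iff intro!: Q.eval_in_carrier)
    have "b \<otimes>\<^bsub>Q\<^esub> v = (fraction R y x \<otimes>\<^bsub>Q\<^esub> tq_embed R x) [^]\<^bsub>Q\<^esub> length cs"
      unfolding b_def v_def by (simp add: Q.nat_pow_distrib)
    also have "fraction R y x \<otimes>\<^bsub>Q\<^esub> tq_embed R x = tq_embed R y"
      unfolding Q_def using y x by (rule tq_fraction)
    also have "tq_embed R y [^]\<^bsub>Q\<^esub> length cs = tq_embed R (y [^] length cs)"
      using y by (simp add: e.ring.hom_nat_pow)
    finally have bv: "b \<otimes>\<^bsub>Q\<^esub> v = tq_embed R (y [^] length cs)" .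
    have pv: "p \<otimes>\<^bsub>Q\<^esub> v = tq_embed R (x \<otimes> bin_form R y x cs)"
      using Cons unfolding p_def v_def by simp
    have "(tq_embed R c \<otimes>\<^bsub>Q\<^esub> b \<oplus>\<^bsub>Q\<^esub> p) \<otimes>\<^bsub>Q\<^esub> (v \<otimes>\<^bsub>Q\<^esub> tq_embed R x) =
      tq_embed R x \<otimes>\<^bsub>Q\<^esub> (tq_embed R c \<otimes>\<^bsub>Q\<^esub> (b \<otimes>\<^bsub>Q\<^esub> v) \<oplus>\<^bsub>Q\<^esub> p \<otimes>\<^bsub>Q\<^esub> v)"
      using cl Cons.prems e.hom_closed[of c] e.hom_closed[of x] by (simp add: Q.l_distr Q.r_distr Q.m_ac)
    also have "\<dots> = tq_embed R (x \<otimes> bin_form R y x (c # cs))"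
      unfolding bv pv using Cons.prems y by simp
    finally show ?case unfolding b_def p_def v_def by simp
  }
qed

text \<open>Multiplying an equation for \<open>y/x\<close> by a power of \<open>x\<close> is
  reversible, because \<open>x\<close> is regular in the base ring and stays so in the total
  quotient ring.\<close>

lemma (in cring) monic_equation_fraction_iff:
  assumes x: "x \<in> non_zero_divisors R" and y: "y \<in> carrier R"
  shows "monic_equation (total_quotient_ring R) (tq_embed R ` carrier R) n (fraction R y x) \<longleftrightarrow>
    (\<exists>cs. length cs = n \<and> set cs \<subseteq> carrier R \<and> y [^] n \<oplus> x \<otimes> bin_form R y x cs = \<zero>)"
proof -
  define Q where "Q = total_quotient_ring R"
  interpret Q: cring Q unfolding Q_def by (rule tq_is_cring)
  interpret e: ring_hom_cring R Q "tq_embed R"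
    unfolding Q_def by (rule tq_embed_ring_hom_cring)
  have xc [simp]: "x \<in> carrier R" using x by (rule nzd_closed)
  have bc [simp]: "fraction R y x \<in> carrier Q" unfolding Q_def using x y by (intro fraction_closed)
  have ev: "ring.eval Q (\<one>\<^bsub>Q\<^esub> # map (tq_embed R) cs) (fraction R y x) = \<zero>\<^bsub>Q\<^esub> \<longleftrightarrow>
    y [^] length cs \<oplus> x \<otimes> bin_form R y x cs = \<zero>" (is "?ev = _ \<longleftrightarrow> ?f = _")
    if cs: "set cs \<subseteq> carrier R" for cs
  proof -
    have ec: "?ev \<in> carrier Q"
      using cs by (intro Q.eval_in_carrier) auto
    have fc: "?f \<in> carrier R" using cs y by simp
    \<comment> \<open>The exponent is one more than the degree, to match the surplus factor
      \<open>x\<close> in \<open>eval_fraction\<close>.\<close>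
    have nz: "tq_embed R x [^]\<^bsub>Q\<^esub> Suc (length cs) \<in> non_zero_divisors Q"
      using tq_embed_nzd[OF x] by (intro Q.nzd_pow) (simp add: Q_def)
    have eq: "?ev \<otimes>\<^bsub>Q\<^esub> tq_embed R x [^]\<^bsub>Q\<^esub> Suc (length cs) = tq_embed R (x \<otimes> ?f)"
      using eval_fraction[OF x y, of "\<one> # cs"] cs y by (simp flip: Q_def)
    have "?ev = \<zero>\<^bsub>Q\<^esub> \<longleftrightarrow> tq_embed R (x \<otimes> ?f) = tq_embed R \<zero>"
      using Q.nzd_mult_eq_zero_iff[OF nz ec] unfolding eq e.hom_zero by blast
    also have "\<dots> \<longleftrightarrow> ?f \<otimes> x = \<zero>"
      using inj_on_eq_iff[OF tq_embed_inj, of "x \<otimes> ?f" \<zero>] fc m_comm[OF fc xc] by simp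
    also have "\<dots> \<longleftrightarrow> ?f = \<zero>"
      using x fc by (rule nzd_mult_eq_zero_iff)
    finally show ?thesis .
  qed
  \<comment> \<open>Coefficient lists over the embedded ring are exactly the images of coefficient
    lists over \<open>R\<close>.\<close>
  have lift: "(\<exists>ds. length ds = n \<and> set ds \<subseteq> tq_embed R ` carrier R \<and> P ds) \<longleftrightarrow>
    (\<exists>cs. length cs = n \<and> set cs \<subseteq> carrier R \<and> P (map (tq_embed R) cs))" for P
  proof
    assume "\<exists>ds. length ds = n \<and> set ds \<subseteq> tq_embed R ` carrier R \<and> P ds"
    then obtain ds where ds: "length ds = n" "set ds \<subseteq> tq_embed R ` carrier R" "P ds" by blast
    then have "ds \<in> map (tq_embed R) ` lists (carrier R)"
      unfolding lists_image[symmetric] by auto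
    then obtain cs where "set cs \<subseteq> carrier R" "ds = map (tq_embed R) cs"
      by (auto simp: lists_eq_set)
    then show "\<exists>cs. length cs = n \<and> set cs \<subseteq> carrier R \<and> P (map (tq_embed R) cs)"
      using ds by auto
  next
    assume "\<exists>cs. length cs = n \<and> set cs \<subseteq> carrier R \<and> P (map (tq_embed R) cs)"
    then obtain cs where "length cs = n" "set cs \<subseteq> carrier R" "P (map (tq_embed R) cs)" by auto
    then show "\<exists>ds. length ds = n \<and> set ds \<subseteq> tq_embed R ` carrier R \<and> P ds"
      by (intro exI[of _ "map (tq_embed R) cs"]) auto
  qed
  show ?thesis
    unfolding monic_equation_def Q_def[symmetric] lift by (rule ex_cong1) (use ev in auto)
qed

text \<open>Noetherianity replaces the determinant trick: the hypothesis puts all powers of \<open>y / x\<close> into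
  \<open>R x\<^sup>-\<^sup>m\<close>, so one of them is a combination of the earlier ones.\<close>

lemma (in cring) integral_over_fraction:
  assumes noeth: "noetherian_ring R" and x: "x \<in> non_zero_divisors R" and y: "y \<in> carrier R"
    and bounded: "\<And>k. \<exists>u\<in>carrier R. x [^] (m::nat) \<otimes> y [^] k = x [^] (k::nat) \<otimes> u"
  shows "integral_over (total_quotient_ring R) (tq_embed R ` carrier R) (fraction R y x)"
proof -
  have xc [simp]: "x \<in> carrier R" using x by (rule nzd_closed)
  \<comment> \<open>\<open>u k\<close> plays the role of \<open>x^m (y/x)^k\<close>.\<close>
  obtain u where u: "\<And>k::nat. u k \<in> carrier R" and eq: "\<And>k. x [^] m \<otimes> y [^] k = x [^] k \<otimes> u k"
    using bounded by metis
  obtain cs where cs: "set cs \<subseteq> carrier R" and comb: "u (length cs) = lin_comb R u cs"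
    using noetherian_lin_comb[OF noeth, of u] u by blast
  \<comment> \<open>Homogenization: \<open>x^n\<close> times the combination of the lower powers of
    \<open>y/x\<close>, scaled by \<open>x^m\<close>, is \<open>x^m\<close> times \<open>x\<close>
    times a binary form.\<close>
  have "x [^] length cs \<otimes> lin_comb R u cs = x [^] m \<otimes> (x \<otimes> bin_form R y x cs)"
    using cs
  proof (induction cs)
    case (Cons c cs)
    define p v f w where "p = lin_comb R u cs" and "v = x [^] length cs" and "f = bin_form R y x cs"
      and "w = x [^] m"
    have cl: "p \<in> carrier R" "v \<in> carrier R" "f \<in> carrier R" "w \<in> carrier R" "c \<in> carrier R"
        "u (length cs) \<in> carrier R" "y [^] length cs \<in> carrier R"
      using Cons.prems u y by (auto simp: p_def v_def f_def w_def intro!: lin_comb_closed)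
    have "v \<otimes> x \<otimes> (c \<otimes> u (length cs) \<oplus> p) = x \<otimes> (c \<otimes> (v \<otimes> u (length cs)) \<oplus> v \<otimes> p)"
      using cl xc by algebra
    also have "\<dots> = x \<otimes> (c \<otimes> (w \<otimes> y [^] length cs) \<oplus> w \<otimes> (x \<otimes> f))"
      using Cons eq[of "length cs"] by (simp add: p_def v_def f_def w_def)
    also have "\<dots> = w \<otimes> (x \<otimes> (c \<otimes> y [^] length cs \<oplus> x \<otimes> f))"
      using cl xc by algebra
    finally show ?case by (simp add: p_def v_def f_def w_def)
  qed simp
  then have "x [^] m \<otimes> y [^] length cs = x [^] m \<otimes> (x \<otimes> bin_form R y x cs)"
    using eq[of "length cs"] comb by simp
  then have rel: "y [^] length cs = x \<otimes> bin_form R y x cs"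
    using nzd_cancel[OF nzd_pow[OF x]] cs y by simp
  have neg: "bin_form R y x (map (a_inv R) cs) = \<ominus> bin_form R y x cs" if "set cs \<subseteq> carrier R" for cs
    using that y by (induction cs) (auto simp: l_minus r_minus minus_add)
  have bc: "fraction R y x \<in> carrier (total_quotient_ring R)" using x y by (intro fraction_closed)
  show ?thesis
  \<comment> \<open>An empty list means \<open>y^0 = \<zero>\<close>, so the ring is zero. An
    integral equation must have degree at least 1, whence the artificial coefficient list
    \<open>[\<zero>]\<close>.\<close>
  proof (cases "cs = []")
    case True
    then have "carrier R = {\<zero>}" using rel xc by (simp add: carrier_one_zero)
    then have "y [^] (1::nat) \<oplus> x \<otimes> bin_form R y x [\<zero>] = \<zero>" using y xc by simp
    then have "monic_equation (total_quotient_ring R) (tq_embed R ` carrier R) 1 (fraction R y x)"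
      unfolding monic_equation_fraction_iff[OF x y] by (intro exI[of _ "[\<zero>]"]) simp
    then show ?thesis unfolding integral_over_def using bc by blast
  next
    case False
    have "y [^] length cs \<oplus> x \<otimes> bin_form R y x (map (a_inv R) cs) = \<zero>"
      using cs y by (simp add: neg rel r_minus r_neg)
    then have "monic_equation (total_quotient_ring R) (tq_embed R ` carrier R) (length cs) (fraction R y x)"
      unfolding monic_equation_fraction_iff[OF x y] using cs by (intro exI[of _ "map (a_inv R) cs"]) auto
    then show ?thesis
      unfolding integral_over_def using bc False by (metis One_nat_def Suc_leI length_greater_0_conv)
  qed
qed


section \<open>Principal reductions and the equations they impose\<close>

lemma (in cring) cgenideal_prod_elem:
  assumes "x \<in> carrier R" "ideal K R" "z \<in> ideal_prod R (PIdl x) K"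
  shows "\<exists>w\<in>K. z = x \<otimes> w"
  using assms(3)
proof (induction rule: ideal_prod.induct)
  interpret K: ideal K R by fact
  {
    case (prod i k)
    then obtain r where r: "r \<in> carrier R" "i = r \<otimes> x" by (auto simp: cgenideal_def)
    then have "i \<otimes> k = x \<otimes> (r \<otimes> k)" using assms(1) K.Icarr[OF prod(2)] by (simp add: m_ac)
    then show ?case using prod r K.I_l_closed by blast
  next
    case (sum s t)
    then obtain v w where "v \<in> K" "w \<in> K" "s = x \<otimes> v" "t = x \<otimes> w" by auto
    then show ?case using assms(1) K.Icarr by (intro bexI[of _ "v \<oplus> w"]) (simp_all add: r_distr)
  }
qed

text \<open>Iterating \<open>I^(m+1) = x I^m\<close> gives \<open>I^(m+k) = x^k I^m\<close>; the
  divisibility by \<open>x^k\<close> bounds the denominators of the powers of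
  \<open>y/x\<close>.\<close>

lemma (in cring) principal_reduction_pow:
  assumes I: "ideal I R" and x: "x \<in> carrier R" and red: "is_reduction R (PIdl x) I"
  shows "\<exists>m. \<forall>k. \<forall>z \<in> ideal_pow R I (m + k). \<exists>u\<in>carrier R. z = x [^] k \<otimes> u"
proof -
  obtain m where m: "ideal_pow R I (Suc m) = ideal_prod R (PIdl x) (ideal_pow R I m)"
    using red by (auto simp: is_reduction_def)
  have P: "ideal (ideal_pow R I k) R" for k using I by (rule ideal_pow_ideal)
  have step: "ideal_pow R I (Suc (m + k)) = ideal_prod R (PIdl x) (ideal_pow R I (m + k))" for k
  proof -
    have "ideal_pow R I (Suc (m + k)) = ideal_prod R (ideal_pow R I (Suc m)) (ideal_pow R I k)"
      using ideal_pow_add[OF I, of "Suc m" k] by simp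
    also have "\<dots> = ideal_prod R (PIdl x) (ideal_pow R I (m + k))"
      unfolding m ideal_prod_assoc[OF cgenideal_ideal[OF x] P P] ideal_pow_add[OF I] ..
    finally show ?thesis .
  qed
  have "\<exists>u\<in>carrier R. z = x [^] k \<otimes> u" if "z \<in> ideal_pow R I (m + k)" for k z
    using that
  proof (induction k arbitrary: z)
    case 0
    then show ?case using ideal.Icarr[OF P] by force
  next
    case (Suc k)
    then obtain w where w: "w \<in> ideal_pow R I (m + k)" "z = x \<otimes> w"
      using cgenideal_prod_elem[OF x P[of "m + k"], of z] step by auto
    then obtain u where "u \<in> carrier R" "w = x [^] k \<otimes> u" using Suc.IH by blast
    then show ?case using w x by (intro bexI[of _ u]) (simp_all add: m_ac)
  qed
  then show ?thesis by blast
qed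

text \<open>The supremum bounds the degree of \<open>b\<close>, and the minimum defining that degree
  is attained because \<open>b\<close> is integral.\<close>

lemma monic_equation_le_degree:
  assumes "ring_integral_degree R = enat d"
    and "integral_over (total_quotient_ring R) (tq_embed R ` carrier R) b"
  shows "\<exists>n. 1 \<le> n \<and> n \<le> d \<and> monic_equation (total_quotient_ring R) (tq_embed R ` carrier R) n b"
proof -
  let ?Q = "total_quotient_ring R" and ?K = "tq_embed R ` carrier R"
  have "enat (elem_integral_degree ?Q ?K b) \<le> ring_integral_degree R"
    unfolding ring_integral_degree_def ext_integral_degree_def Let_def
    using assms(2) by (intro SUP_upper) (simp add: integral_closure_def)
  then have "elem_integral_degree ?Q ?K b \<le> d" using assms(1) by simp
  moreover have "1 \<le> elem_integral_degree ?Q ?K b \<and> monic_equation ?Q ?K (elem_integral_degree ?Q ?K b) b"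
    unfolding elem_integral_degree_def
    using assms(2) unfolding integral_over_def by (elim conjE exE) (rule LeastI, blast)
  ultimately show ?thesis by blast
qed

lemma (in cring) regular_principal_reduction_equation:
  assumes noeth: "noetherian_ring R" and deg: "ring_integral_degree R = enat d"
    and I: "ideal I R" and red: "is_principal_reduction R J I" and reg: "is_regular_ideal R J"
  shows "\<exists>x \<in> I \<inter> non_zero_divisors R. \<forall>y\<in>I. \<exists>cs. cs \<noteq> [] \<and> length cs \<le> d \<and>
    set cs \<subseteq> carrier R \<and> y [^] length cs \<oplus> x \<otimes> bin_form R y x cs = \<zero>"
proof -
  interpret I: ideal I R by fact
  obtain x where x: "x \<in> carrier R" "J = PIdl x"
    using red principalideal.generate[of J R]
    by (auto simp: is_principal_reduction_def cgenideal_eq_genideal)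
  have J: "J \<subseteq> I" "is_reduction R (PIdl x) I"
    using red x by (auto simp: is_principal_reduction_def is_reduction_def)
  have xI: "x \<in> I" using J x cgenideal_self by blast
  obtain s r where s: "s \<in> non_zero_divisors R" "r \<in> carrier R" "s = r \<otimes> x"
    using reg unfolding is_regular_ideal_def x cgenideal_def by auto
  \<comment> \<open>A factor of a non zero divisor is a non zero divisor, so the generator inherits
    regularity from \<open>s = r x\<close>.\<close>
  have nz: "x \<in> non_zero_divisors R"
    unfolding non_zero_divisors_def
  proof (intro CollectI conjI ballI impI)
    fix z assume z: "z \<in> carrier R" "x \<otimes> z = \<zero>"
    then have "s \<otimes> z = \<zero>" using s x by (simp add: m_assoc)
    then show "z = \<zero>" using s z by (simp add: non_zero_divisors_def)
  qed (rule x)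
  obtain m where m: "\<And>k z. z \<in> ideal_pow R I (m + k) \<Longrightarrow> \<exists>u\<in>carrier R. z = x [^] k \<otimes> u"
    using principal_reduction_pow[OF I x(1) J(2)] by blast
  have "\<exists>cs. cs \<noteq> [] \<and> length cs \<le> d \<and> set cs \<subseteq> carrier R \<and>
      y [^] length cs \<oplus> x \<otimes> bin_form R y x cs = \<zero>" if y: "y \<in> I" for y
  proof -
    have yc: "y \<in> carrier R" using y by (rule I.Icarr)
    have "x [^] m \<otimes> y [^] k \<in> ideal_pow R I (m + k)" for k
      unfolding ideal_pow_add[OF I, symmetric]
      using xI y by (intro ideal_prod.prod pow_mem_ideal_pow I)
    then have "integral_over (total_quotient_ring R) (tq_embed R ` carrier R) (fraction R y x)"
      using m by (intro integral_over_fraction[OF noeth nz yc]) blast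
    then obtain n where "1 \<le> n" "n \<le> d"
      "monic_equation (total_quotient_ring R) (tq_embed R ` carrier R) n (fraction R y x)"
      using monic_equation_le_degree[OF deg] by blast
    then obtain cs where "length cs = n" "set cs \<subseteq> carrier R"
      "y [^] n \<oplus> x \<otimes> bin_form R y x cs = \<zero>"
      unfolding monic_equation_fraction_iff[OF nz yc] by blast
    then show ?thesis using \<open>1 \<le> n\<close> \<open>n \<le> d\<close> by (intro exI[of _ cs]) auto
  qed
  then show ?thesis using xI nz by blast
qed


subsection \<open>The intersection formula\<close>

lemma (in ideal) rcos_eq_zero_iff:
  assumes "z \<in> carrier R"
  shows "I +> z = \<zero>\<^bsub>R Quot I\<^esub> \<longleftrightarrow> z \<in> I"
  using a_coset_join1[OF _ assms a_subgroup] a_rcos_const by (auto simp: FactRing_def)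

lemma (in ideal) image_rcos_carrier: "((+>) I) ` carrier R = carrier (R Quot I)"
  by (auto simp: FactRing_def A_RCOSETS_def')

lemma (in cring) pow_inter_ideal:
  assumes I: "ideal I R" and a: "ideal \<aa> R" and x: "x \<in> I"
    and cancel: "\<And>z. z \<in> carrier R \<Longrightarrow> x \<otimes> z \<in> \<aa> \<Longrightarrow> z \<in> \<aa>"
    and d: "1 \<le> d"
    and dec: "ideal_pow R I d \<subseteq> ideal_prod R (PIdl x) (ideal_pow R I (d - 1)) <+> \<aa>"
    and n: "d \<le> n"
  shows "ideal_pow R I n \<inter> \<aa> = ideal_prod R (ideal_pow R I (n - d)) (ideal_pow R I d \<inter> \<aa>)"
proof -
  interpret I: ideal I R by fact
  interpret a: ideal \<aa> R by fact
  have P: "ideal (ideal_pow R I k) R" for k using I by (rule ideal_pow_ideal)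
  have Pc: "z \<in> carrier R" if "z \<in> ideal_pow R I k" for z k using ideal.Icarr[OF P that] .
  have xc [simp]: "x \<in> carrier R" using x by (rule I.Icarr)
  define K where "K = ideal_pow R I d \<inter> \<aa>"
  have K: "ideal K R" unfolding K_def using P a by (rule i_intersect)
  have PK: "ideal (ideal_prod R (ideal_pow R I k) K) R" for k using P K by (rule ideal_prod_is_ideal)
  have xmul: "x \<otimes> w \<in> ideal_pow R I (Suc k)" if "w \<in> ideal_pow R I k" for w k
    using ideal_prod.prod[OF that x, of R] Pc[OF that] by (simp add: ideal_pow_Suc m_comm)
  \<comment> \<open>Since \<open>x w\<close> already lies in \<open>I^d\<close>, so does the
    remainder \<open>v = j - x w\<close>; thus \<open>v\<close> belongs to \<open>K\<close> and not
    merely to \<open>\<aa>\<close>.\<close>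
  have base: "\<exists>w\<in>ideal_pow R I (d - 1). \<exists>v\<in>K. j = x \<otimes> w \<oplus> v" if j: "j \<in> ideal_pow R I d" for j
  proof -
    obtain i v where i: "i \<in> ideal_prod R (PIdl x) (ideal_pow R I (d - 1))" and v: "v \<in> \<aa>"
      and j_eq: "j = i \<oplus> v"
      using subsetD[OF dec j] unfolding set_add_def' by blast
    obtain w where w: "w \<in> ideal_pow R I (d - 1)" and i_eq: "i = x \<otimes> w"
      using cgenideal_prod_elem[OF xc P i] by blast
    have eq: "j = x \<otimes> w \<oplus> v" unfolding j_eq i_eq ..
    interpret D: ideal "ideal_pow R I d" R by (rule P)
    have c: "w \<in> carrier R" "v \<in> carrier R" using w v Pc a.Icarr by auto
    have "x \<otimes> w \<in> ideal_pow R I d" using xmul[OF w] d by simp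
    then have "j \<ominus> x \<otimes> w \<in> ideal_pow R I d" using j by (simp add: minus_eq)
    moreover have "j \<ominus> x \<otimes> w = v" unfolding eq using c xc by algebra
    ultimately show ?thesis using w v eq unfolding K_def by blast
  qed
  have split: "\<exists>w\<in>ideal_pow R I (k + d). \<exists>v\<in>ideal_prod R (ideal_pow R I (Suc k)) K. z = x \<otimes> w \<oplus> v"
    if "z \<in> ideal_prod R (ideal_pow R I (Suc k)) (ideal_pow R I d)" for z k
    using that
  proof (induction rule: ideal_prod.induct)
    case (prod i j)
    obtain w v where w: "w \<in> ideal_pow R I (d - 1)" and v: "v \<in> K" and eq: "j = x \<otimes> w \<oplus> v"
      using base[OF prod(2)] by blast
    have c: "i \<in> carrier R" "w \<in> carrier R" "v \<in> carrier R"
      using Pc[OF prod(1)] Pc[OF w] ideal.Icarr[OF K v] by auto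
    \<comment> \<open>The exponents \<open>k + 1\<close> and \<open>d - 1\<close> add up to
      \<open>k + d\<close> because \<open>d \<ge> 1\<close>.\<close>
    have "i \<otimes> w \<in> ideal_prod R (ideal_pow R I (Suc k)) (ideal_pow R I (d - 1))"
      using prod(1) w by (rule ideal_prod.prod)
    then have "i \<otimes> w \<in> ideal_pow R I (k + d)"
      unfolding ideal_pow_add[OF I] using d by simp
    moreover have "i \<otimes> v \<in> ideal_prod R (ideal_pow R I (Suc k)) K"
      using prod(1) v by (rule ideal_prod.prod)
    moreover have "i \<otimes> j = x \<otimes> (i \<otimes> w) \<oplus> i \<otimes> v" unfolding eq using c xc by algebra
    ultimately show ?case by blast
  next
    case (sum s t)
    then obtain w v w' v' where h: "w \<in> ideal_pow R I (k + d)" "w' \<in> ideal_pow R I (k + d)"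
      "v \<in> ideal_prod R (ideal_pow R I (Suc k)) K" "v' \<in> ideal_prod R (ideal_pow R I (Suc k)) K"
      "s = x \<otimes> w \<oplus> v" "t = x \<otimes> w' \<oplus> v'" by blast
    have c: "w \<in> carrier R" "w' \<in> carrier R" "v \<in> carrier R" "v' \<in> carrier R"
      using Pc[OF h(1)] Pc[OF h(2)] ideal.Icarr[OF PK h(3)] ideal.Icarr[OF PK h(4)] by simp_all
    have "s \<oplus> t = x \<otimes> (w \<oplus> w') \<oplus> (v \<oplus> v')" unfolding h(5,6) using c xc by algebra
    moreover have "w \<oplus> w' \<in> ideal_pow R I (k + d)"
      using h(1,2) by (rule additive_subgroup.a_closed[OF ideal.axioms(1)[OF P]])
    moreover have "v \<oplus> v' \<in> ideal_prod R (ideal_pow R I (Suc k)) K"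
      using h(3,4) by (rule ideal_prod.sum)
    ultimately show ?case by blast
  qed
  have "z \<in> ideal_prod R (ideal_pow R I k) K" if "z \<in> ideal_pow R I (k + d)" "z \<in> \<aa>" for k z
    using that
  proof (induction k arbitrary: z)
    case 0
    have "\<one> \<otimes> z \<in> ideal_prod R (ideal_pow R I 0) K"
      by (rule ideal_prod.prod) (use 0 in \<open>simp_all add: K_def\<close>)
    then show ?case using a.Icarr[OF 0(2)] by simp
  next
    case (Suc k)
    have zP: "z \<in> ideal_prod R (ideal_pow R I (Suc k)) (ideal_pow R I d)"
      using Suc.prems(1) unfolding ideal_pow_add[OF I] .
    obtain w v where w: "w \<in> ideal_pow R I (k + d)"
      and v: "v \<in> ideal_prod R (ideal_pow R I (Suc k)) K" and eq: "z = x \<otimes> w \<oplus> v"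
      using split[OF zP] by blast
    have va: "v \<in> \<aa>" using subsetD[OF ideal_prod_inter[OF P K] v] by (simp add: K_def)
    have c: "w \<in> carrier R" "v \<in> carrier R" using Pc[OF w] a.Icarr[OF va] by auto
    have "z \<ominus> v \<in> \<aa>" using va Suc.prems(2) unfolding minus_eq by (intro a.a_closed a.a_inv_closed)
    moreover have "z \<ominus> v = x \<otimes> w" unfolding eq using c xc by algebra
    ultimately have "w \<in> \<aa>" using cancel[OF c(1)] by metis
    then have "w \<in> ideal_prod R (ideal_pow R I k) K" using w Suc.IH by blast
    then have "x \<otimes> w \<in> ideal_prod R I (ideal_prod R (ideal_pow R I k) K)"
      by (rule ideal_prod.prod[OF x])
    then have "x \<otimes> w \<in> ideal_prod R (ideal_pow R I (Suc k)) K"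
      unfolding ideal_pow_Suc ideal_prod_commute[OF P I] ideal_prod_assoc[OF I P K] .
    then show ?case unfolding eq using v by (rule ideal_prod.sum)
  qed
  then have "ideal_pow R I (n - d + d) \<inter> \<aa> \<subseteq> ideal_prod R (ideal_pow R I (n - d)) K" by blast
  then have "ideal_pow R I n \<inter> \<aa> \<subseteq> ideal_prod R (ideal_pow R I (n - d)) K" using n by simp
  moreover have "ideal_prod R (ideal_pow R I (n - d)) K \<subseteq> ideal_pow R I n"
    using ideal_prod_mono[OF subset_refl, of K "ideal_pow R I d" R "ideal_pow R I (n - d)"]
      ideal_pow_add[OF I, of "n - d" d] n
    unfolding K_def by simp
  moreover have "ideal_prod R (ideal_pow R I (n - d)) K \<subseteq> \<aa>"
    using ideal_prod_inter[OF P[of "n - d"] K] by (auto simp: K_def)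
  ultimately show ?thesis unfolding K_def by blast
qed

theorem theorem8p3:
  fixes A :: "('a, 'b) ring_scheme" (structure)
    and \<aa> I :: "'a set" and d :: nat
  assumes "cring A" and "noetherian_ring A" and "contains_rat A"
    and "ideal \<aa> A"
    and "ring_integral_degree (A Quot \<aa>) = enat d"
    and "ideal I A"
    and "\<exists>J. is_principal_reduction (A Quot \<aa>) J (ideal_ext A \<aa> I) \<and> is_regular_ideal (A Quot \<aa>) J"
  shows "\<forall>n\<ge>d. ideal_pow A I n \<inter> \<aa> = ideal_prod A (ideal_pow A I (n - d)) (ideal_pow A I d \<inter> \<aa>)"
proof -
  interpret A: cring A by fact
  interpret a: ideal \<aa> A by fact
  interpret I: ideal I A by fact
  interpret Q: cring "A Quot \<aa>" using assms(1) by (rule a.quotient_is_cring)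
  interpret \<pi>: ring_hom_cring A "A Quot \<aa>" "\<lambda>z. \<aa> +> z" using assms(1) by (rule a.rcos_ring_hom_cring)
  have surj: "(\<lambda>z. \<aa> +> z) ` carrier A = carrier (A Quot \<aa>)"
    by (rule a.image_rcos_carrier)
  have noeth: "noetherian_ring (A Quot \<aa>)"
    using assms(2) surj by (rule \<pi>.ring.noetherian_ring_image)
  have imI: "(\<lambda>z. \<aa> +> z) ` I \<subseteq> carrier (A Quot \<aa>)" unfolding surj[symmetric] by (rule image_mono[OF I.a_subset])
  have extI: "ideal (ideal_ext A \<aa> I) (A Quot \<aa>)"
    unfolding ideal_ext_def using imI by (rule Q.genideal_ideal)
  \<comment> \<open>The projection is onto, so the image of \<open>I\<close> is already an ideal;
    hence the regular element \<open>x'\<close> found below lifts to an element of \<open>I\<close>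
    itself.\<close>
  have ext_sub: "ideal_ext A \<aa> I \<subseteq> (\<lambda>z. \<aa> +> z) ` I"
    unfolding ideal_ext_def using A.ring_ideal_imp_quot_ideal[OF assms(4,6)]
    by (rule Q.genideal_minimal) (rule subset_refl)
  have ext_mem: "\<aa> +> y \<in> ideal_ext A \<aa> I" if "y \<in> I" for y
    unfolding ideal_ext_def by (rule subsetD[OF Q.genideal_self[OF imI] imageI[OF that]])
  obtain J where J: "is_principal_reduction (A Quot \<aa>) J (ideal_ext A \<aa> I)"
    "is_regular_ideal (A Quot \<aa>) J" using assms(7) by blast
  obtain x' where x': "x' \<in> ideal_ext A \<aa> I \<inter> non_zero_divisors (A Quot \<aa>)"
    and eq: "\<forall>y\<in>ideal_ext A \<aa> I. \<exists>cs. cs \<noteq> [] \<and> length cs \<le> d \<and> set cs \<subseteq> carrier (A Quot \<aa>) \<and>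
      y [^]\<^bsub>A Quot \<aa>\<^esub> length cs \<oplus>\<^bsub>A Quot \<aa>\<^esub> x' \<otimes>\<^bsub>A Quot \<aa>\<^esub> bin_form (A Quot \<aa>) y x' cs = \<zero>\<^bsub>A Quot \<aa>\<^esub>"
    using Q.regular_principal_reduction_equation[OF noeth assms(5) extI J] by (rule bexE)
  obtain x where x: "x \<in> I" "x' = \<aa> +> x" using x' ext_sub by blast
  have xc: "x \<in> carrier A" using x(1) by (rule I.Icarr)
  have cancel: "z \<in> \<aa>" if z: "z \<in> carrier A" "x \<otimes> z \<in> \<aa>" for z
  proof -
    have "x' \<otimes>\<^bsub>A Quot \<aa>\<^esub> (\<aa> +> z) = \<aa> +> (x \<otimes> z)"
      unfolding x(2) using xc z(1) by (rule \<pi>.hom_mult[symmetric])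
    also have "\<dots> = \<zero>\<^bsub>A Quot \<aa>\<^esub>"
      using z xc by (subst a.rcos_eq_zero_iff) simp_all
    finally have "\<aa> +> z = \<zero>\<^bsub>A Quot \<aa>\<^esub>"
      using x' \<pi>.hom_closed[OF z(1)] unfolding non_zero_divisors_def by blast
    then show ?thesis using z(1) by (simp only: a.rcos_eq_zero_iff)
  qed
  have P: "ideal (ideal_pow A I k) A" for k using assms(6) by (rule A.ideal_pow_ideal)
  let ?D = "ideal_prod A (PIdl x) (ideal_pow A I (d - 1))"
  have D: "ideal ?D A" using A.cgenideal_ideal[OF xc] P by (rule A.ideal_prod_is_ideal)
  have DA: "ideal (set_add A ?D \<aa>) A" using D assms(4) by (rule A.add_ideals)
  have pow: "y [^] d \<in> set_add A ?D \<aa>" if y: "y \<in> I" for y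
  proof -
    have yc: "y \<in> carrier A" using y by (rule I.Icarr)
    obtain cs' where cs': "cs' \<noteq> []" "length cs' \<le> d" "set cs' \<subseteq> (\<lambda>z. \<aa> +> z) ` carrier A"
      "(\<aa> +> y) [^]\<^bsub>A Quot \<aa>\<^esub> length cs' \<oplus>\<^bsub>A Quot \<aa>\<^esub>
        x' \<otimes>\<^bsub>A Quot \<aa>\<^esub> bin_form (A Quot \<aa>) (\<aa> +> y) x' cs' = \<zero>\<^bsub>A Quot \<aa>\<^esub>"
      using bspec[OF eq ext_mem[OF y]] unfolding surj by (elim exE conjE)
    then have "cs' \<in> map (\<lambda>z. \<aa> +> z) ` lists (carrier A)"
      unfolding lists_image[symmetric] by auto
    then obtain cs where cs: "set cs \<subseteq> carrier A" "cs' = map (\<lambda>z. \<aa> +> z) cs"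
      by (auto simp: lists_eq_set)
    let ?n = "length cs" and ?f = "bin_form A y x cs"
    have n: "1 \<le> ?n" "?n \<le> d" "cs \<noteq> []" using cs'(1,2) cs(2) by (auto simp: Suc_le_eq)
    have fc: "?f \<in> carrier A" using cs(1) yc xc by simp
    have "\<aa> +> (y [^] ?n \<oplus> x \<otimes> ?f) = \<zero>\<^bsub>A Quot \<aa>\<^esub>"
      using cs'(4) cs yc xc fc unfolding x(2)
      by (simp add: \<pi>.ring.hom_bin_form[OF assms(1)] \<pi>.ring.hom_nat_pow)
    then have mem: "y [^] ?n \<oplus> x \<otimes> ?f \<in> \<aa>"
      using yc xc fc by (subst (asm) a.rcos_eq_zero_iff) simp_all
    have pc: "y [^] (d - ?n) \<in> carrier A" "y [^] ?n \<in> carrier A" using yc by auto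
    \<comment> \<open>The equation for \<open>y\<close> has degree \<open>?n\<close>, possibly
      smaller than \<open>d\<close>; the factor \<open>y^(d - ?n)\<close> raises the form of degree
      \<open>?n - 1\<close> to degree \<open>d - 1\<close>.\<close>
    have "(d - ?n) + (?n - 1) = d - 1" using n by simp
    then have "y [^] (d - ?n) \<otimes> ?f \<in> ideal_pow A I (d - 1)"
      using ideal_prod.prod[OF A.pow_mem_ideal_pow[OF assms(6) y] A.bin_form_mem_ideal_pow[OF assms(6) x(1) y cs(1) n(3)],
          of A "d - ?n"] A.ideal_pow_add[OF assms(6), of "d - ?n" "?n - 1"] by simp
    then have "\<ominus> x \<otimes> (y [^] (d - ?n) \<otimes> ?f) \<in> ?D"
      using A.cgenideal_self[OF xc] A.cgenideal_ideal[OF xc]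
      by (intro ideal_prod.prod) (auto intro: additive_subgroup.a_inv_closed ideal.axioms)
    moreover have "(y [^] ?n \<oplus> x \<otimes> ?f) \<otimes> y [^] (d - ?n) \<in> \<aa>"
      using mem pc by (intro a.I_r_closed)
    \<comment> \<open>This sum is \<open>y^d\<close>: its first summand cancels the multiple of
      \<open>x\<close> in the lifted relation and lies in \<open>?D\<close>, and its second lies in
      \<open>\<aa>\<close>.\<close>
    ultimately have "\<ominus> x \<otimes> (y [^] (d - ?n) \<otimes> ?f) \<oplus> (y [^] ?n \<oplus> x \<otimes> ?f) \<otimes> y [^] (d - ?n) \<in> set_add A ?D \<aa>"
      unfolding set_add_def' by blast
    also have "\<ominus> x \<otimes> (y [^] (d - ?n) \<otimes> ?f) \<oplus> (y [^] ?n \<oplus> x \<otimes> ?f) \<otimes> y [^] (d - ?n) =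
        y [^] ?n \<otimes> y [^] (d - ?n)"
      using pc fc xc by algebra
    also have "\<dots> = y [^] d" using n yc by (simp add: A.nat_pow_mult)
    finally show ?thesis .
  qed
  \<comment> \<open>The equation for \<open>x'\<close> itself has a nonempty coefficient list of
    length at most \<open>d\<close>.\<close>
  have d: "1 \<le> d" using bspec[OF eq, of x'] x' by (cases d) auto
  obtain \<iota> where "\<iota> \<in> ring_hom rat_ring A" using assms(3) by (auto simp: contains_rat_def)
  then interpret rat_cring A \<iota> by unfold_locales
  have "ideal_pow A I d \<subseteq> set_add A ?D \<aa>" using ideal_pow_subset[OF assms(6) DA pow] .
  then show ?thesis
    using A.pow_inter_ideal[OF assms(6,4) x(1) cancel d] by blast
qed

end
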